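(* Let $X$ be a non-metrizable sequential rectifiable regular topological space of countable $\mathrm{cs}^*$-character. Then $X$ contains a clopen subspace $H$ which is a rectifiable $sk_\omega$-space, and $X$ admits a cover by pairwise disjoint open subsets each of which is homeomorphic to a clopen subspace of $H$.
   Context: All topological spaces are assumed to be regular (including the $T_1$ axiom). A topological space $X$ is rectifiable if there exist a point $e\in X$ and a homeomorphism $h:X\times X\to X\times X$ such that $h(x,e)=(x,x)$ and $h(\{x\}\times X)\subset\{x\}\times X$ for every $x\in X$. A family $\mathcal N$ of subsets of $X$ is a $\mathrm{cs}^*$-network at a point $x\in X$ if for each neighborhood $O_x$ of $x$ and each sequence $(x_n)_{n\in\omega}$ in $X$ converging to $x$ there is $N\in\mathcal N$ such that $x\in N\subset O_x$ and $x_n\in N$ for infinitely many $n$. The space $X$ has countable $\mathrm{cs}^*$-character if at each point $x\in X$ it has a countable $\mathrm{cs}^*$-network. A space $X$ is sequential if for each non-closed subset $A\subset X$ there is a sequence in $A$ that converges in $X$ to a point $x\notin A$. A space $X$ is an $sk_\omega$-space if there is a countable cover $\mathcal K$ of $X$ by compact metrizable subspaces such that a set $A\subset X$ is closed in $X$ if and only if $A\cap K$ is closed in $K$ for every $K\in\mathcal K$. Clopen means closed and open. *)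

theory Defs
  imports "HOL-Analysis.Analysis"
begin

definition rectifiable_space :: "'a topology \<Rightarrow> bool" where
  "rectifiable_space X \<longleftrightarrow>
     (\<exists>e \<in> topspace X. \<exists>h. homeomorphic_map (prod_topology X X) (prod_topology X X) h \<and>
        (\<forall>x \<in> topspace X. h (x, e) = (x, x) \<and>
           h ` ({x} \<times> topspace X) \<subseteq> {x} \<times> topspace X))"

(* It suffices to quantify over open neighborhoods, since enlarging the neighborhood U
   only weakens the requirement. *)
definition cs_star_network_at :: "'a topology \<Rightarrow> 'a set set \<Rightarrow> 'a \<Rightarrow> bool" where
  "cs_star_network_at X \<N> x \<longleftrightarrow>
     \<N> \<subseteq> Pow (topspace X) \<and>
     (\<forall>U \<sigma>. openin X U \<and> x \<in> U \<and> range \<sigma> \<subseteq> topspace X \<and> limitin X \<sigma> x sequentially \<longrightarrow>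
        (\<exists>N\<in>\<N>. x \<in> N \<and> N \<subseteq> U \<and> infinite {n::nat. \<sigma> n \<in> N}))"

definition countable_cs_star_character :: "'a topology \<Rightarrow> bool" where
  "countable_cs_star_character X \<longleftrightarrow>
     (\<forall>x \<in> topspace X. \<exists>\<N>. countable \<N> \<and> cs_star_network_at X \<N> x)"

definition sequential_space :: "'a topology \<Rightarrow> bool" where
  "sequential_space X \<longleftrightarrow>
     (\<forall>A. A \<subseteq> topspace X \<and> \<not> closedin X A \<longrightarrow>
        (\<exists>\<sigma> l. range \<sigma> \<subseteq> A \<and> limitin X \<sigma> l sequentially \<and> l \<notin> A))"

definition sk_omega_space :: "'a topology \<Rightarrow> bool" where
  "sk_omega_space X \<longleftrightarrow>
     (\<exists>\<K>. countable \<K> \<and> \<Union>\<K> = topspace X \<and>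
        (\<forall>K\<in>\<K>. compact_space (subtopology X K) \<and> metrizable_space (subtopology X K)) \<and>
        (\<forall>A. A \<subseteq> topspace X \<longrightarrow>
           (closedin X A \<longleftrightarrow> (\<forall>K\<in>\<K>. closedin (subtopology X K) (A \<inter> K)))))"

end

theory Submission
  imports Defs
begin

text \<open>A rectification is a left-invertible multiplication p with continuous left division q and right
  unit e. If sequences of sequences converging to e can be diagonalized, then sequential barriers are
  neighbourhoods, so the countable cs*-network makes X first countable at e, hence metrizable. If
  not, an undiagonalizable sheaf at e forces all members of a closed cs-network inside some
  neighbourhood of e to be sequentially compact, and sequentially compact sets are compact and
  metrizable. The set H generated from these members by p and q is then a union of countably many
  compact metrizable sets, one of which absorbs any sequence converging to a point of H. This makes H
  and every set stable under right multiplication by H clopen; well-ordering the orbits of right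
  multiplication and cutting each along countably many left translates of H gives the cover.\<close>

subsection \<open>Metrization by a sequence of entourages\<close>

text \<open>The guiding model is a topological group with \<open>p x y = xy\<close> and
  \<open>q x y = x^-1 y\<close>, where \<open>H\<close> would be an open subgroup and the cover its
  cosets. Here \<open>p\<close> need not be associative. What survives is transport to
  \<open>e\<close>: since \<open>q x x = e\<close>, a sequence of points tends to \<open>x\<close>
  exactly when its quotients by \<open>x\<close> tend to \<open>e\<close>, so a network at the
  single point \<open>e\<close> controls all convergence. What is lost is uniformity: translates of
  neighbourhoods of \<open>e\<close> need not compose with an index independent of the point, so
  metrization goes through a pointwise condition; and translates of \<open>H\<close> need not be
  disjoint or stable under right multiplication by \<open>H\<close>, so orbits are needed. Two
  pathologies at \<open>e\<close> compete: sheaves that cannot be diagonalized, and arbitrarily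
  small network members that are not sequentially compact. Joint continuity of \<open>p\<close> at
  \<open>(e, e)\<close> excludes having both. Diagonalization, even when it fails in
  \<open>X\<close>, holds inside every sequentially compact set. This is why barriers are taken
  relative to a set \<open>L\<close>: letting \<open>L\<close> consist of the quotients of points of
  \<open>K\<close> metrizes \<open>K\<close>.\<close>

inductive weighted_chain :: "'a set \<Rightarrow> ('a \<Rightarrow> 'a \<Rightarrow> real) \<Rightarrow> nat \<Rightarrow> 'a \<Rightarrow> 'a \<Rightarrow> real \<Rightarrow> bool"
  for M f where
  refl: "x \<in> M \<Longrightarrow> weighted_chain M f 0 x x 0"
| step: "weighted_chain M f n x y r \<Longrightarrow> z \<in> M \<Longrightarrow> weighted_chain M f (Suc n) x z (r + f y z)"

lemma weighted_chain_in: "weighted_chain M f n x y r \<Longrightarrow> x \<in> M \<and> y \<in> M"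
  by (induction rule: weighted_chain.induct) auto

lemma weighted_chain_nonneg:
  assumes "\<And>x y. 0 \<le> f x y"
  shows "weighted_chain M f n x y r \<Longrightarrow> 0 \<le> r"
  by (induction rule: weighted_chain.induct) (auto simp: assms)

lemma weighted_chain_trans:
  assumes "weighted_chain M f m y z s" "weighted_chain M f n x y r"
  shows "weighted_chain M f (n + m) x z (r + s)"
  using assms
proof (induction rule: weighted_chain.induct)
  case (step m y z s z')
  then show ?case
    using weighted_chain.step[of M f "n + m" x z "r + s" z'] by (simp add: add.assoc)
qed simp

lemma weighted_chain_single:
  assumes "x \<in> M" "y \<in> M"
  shows "weighted_chain M f 1 x y (f x y)"
  using weighted_chain.step[OF weighted_chain.refl, of x M y f] assms by simp

lemma weighted_chain_sym:
  assumes "\<And>x y. f x y = f y x"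
  shows "weighted_chain M f n x y r \<Longrightarrow> weighted_chain M f n y x r"
proof (induction rule: weighted_chain.induct)
  case (step n x y r z)
  have "y \<in> M"
    using step weighted_chain_in by fast
  then show ?case
    using weighted_chain_trans[OF step.IH weighted_chain_single[of z M y f]] step.hyps assms[of y z]
    by (simp add: add.commute)
qed (auto intro: weighted_chain.refl)

text \<open>The cut is made at the first edge where the partial weight passes \<open>t\<close>, or
  at the last edge if that never happens; the latter case, with an empty remainder of weight 0,
  accounts for the \<open>max\<close>.\<close>

lemma weighted_chain_split:
  assumes f: "\<And>x y. 0 \<le> f x y" and "0 \<le> t"
  shows "weighted_chain M f n x y r \<Longrightarrow> 0 < n \<Longrightarrow>
    \<exists>m k a b s u. m < n \<and> k < n \<and> weighted_chain M f m x a s \<and> s \<le> t \<and> f a b \<le> r \<and>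
      weighted_chain M f k b y u \<and> u \<le> max 0 (r - t)"
proof (induction rule: weighted_chain.induct)
  case (step n x y r z)
  show ?case
  proof (cases "r \<le> t")
    case True
    have "0 \<le> r"
      using step.hyps f weighted_chain_nonneg by metis
    then show ?thesis
      using step.hyps True weighted_chain.refl[of z M f]
      by (intro exI[of _ n] exI[of _ 0] exI[of _ y] exI[of _ z] exI[of _ r]) auto
  next
    case False
    have "0 < n"
    proof (rule ccontr)
      assume "\<not> 0 < n"
      with step.hyps(1) have "r = 0"
        by (auto elim: weighted_chain.cases)
      with False \<open>0 \<le> t\<close> show False by simp
    qed
    then obtain m k a b s u where *: "m < n" "k < n" "weighted_chain M f m x a s" "s \<le> t"
      "f a b \<le> r" "weighted_chain M f k b y u" "u \<le> max 0 (r - t)"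
      using step.IH by blast
    have "weighted_chain M f (Suc k) b z (u + f y z)"
      using * step.hyps by (auto intro: weighted_chain.step)
    moreover have "u + f y z \<le> max 0 (r + f y z - t)" "f a b \<le> r + f y z"
      using * False f[of y z] by auto
    ultimately show ?thesis
      using * by (intro exI[of _ m] exI[of _ "Suc k"] exI[of _ a] exI[of _ b]) auto
  qed
qed auto

text \<open>The argument of Frink: cutting a chain of total weight r at its middle yields an edge and two
  shorter chains of weight at most r/2.\<close>
lemma weighted_chain_entourage:
  fixes E :: "nat \<Rightarrow> 'a \<Rightarrow> 'a \<Rightarrow> bool"
  assumes f: "\<And>x y. 0 \<le> f x y"
    and refl: "\<And>n x. x \<in> M \<Longrightarrow> E n x x"
    and triple: "\<And>n w x y z. \<lbrakk>E (Suc n) w x; E (Suc n) x y; E (Suc n) y z;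
        w \<in> M; x \<in> M; y \<in> M; z \<in> M\<rbrakk> \<Longrightarrow> E n w z"
    and small: "\<And>n x y. \<lbrakk>f x y < (1/2)^n; x \<in> M; y \<in> M\<rbrakk> \<Longrightarrow> E (Suc n) x y"
  shows "weighted_chain M f k x y r \<Longrightarrow> r < (1/2)^n \<Longrightarrow> E n x y"
proof (induction k arbitrary: x y r n rule: less_induct)
  case (less k)
  have xy: "x \<in> M" "y \<in> M"
    using weighted_chain_in[OF less.prems(1)] by auto
  show ?case
  proof (cases "k = 0")
    case True
    with less.prems have "x = y"
      by (auto elim: weighted_chain.cases)
    then show ?thesis
      using refl xy by auto
  next
    case False
    have r: "0 \<le> r"
      using less.prems f weighted_chain_nonneg by metis
    obtain m k' a b s u where *: "m < k" "k' < k" "weighted_chain M f m x a s" "s \<le> r/2"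
      "f a b \<le> r" "weighted_chain M f k' b y u" "u \<le> max 0 (r - r/2)"
      using weighted_chain_split[of f "r/2" M k x y r] f r less.prems False by auto
    have "a \<in> M" "b \<in> M"
      using * weighted_chain_in by fast+
    moreover have "E (Suc n) x a" "E (Suc n) b y"
      using less.IH * less.prems r by auto
    moreover have "E (Suc n) a b"
      using small * less.prems \<open>a \<in> M\<close> \<open>b \<in> M\<close> by fastforce
    ultimately show ?thesis
      using triple xy by blast
  qed
qed

lemma entourage_metric_triple:
  fixes E :: "nat \<Rightarrow> 'a \<Rightarrow> 'a \<Rightarrow> bool"
  assumes E0: "\<And>x y. E 0 x y"
    and refl: "\<And>n x. x \<in> M \<Longrightarrow> E n x x"
    and sym: "\<And>n x y. E n x y \<Longrightarrow> E n y x"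
    and mono: "\<And>n x y. \<lbrakk>E (Suc n) x y; x \<in> M; y \<in> M\<rbrakk> \<Longrightarrow> E n x y"
    and triple: "\<And>n w x y z. \<lbrakk>E (Suc n) w x; E (Suc n) x y; E (Suc n) y z;
        w \<in> M; x \<in> M; y \<in> M; z \<in> M\<rbrakk> \<Longrightarrow> E n w z"
    and sep: "\<And>x y. \<lbrakk>x \<in> M; y \<in> M; \<And>n. E n x y\<rbrakk> \<Longrightarrow> x = y"
  obtains d where "Metric_space M d"
    "\<And>n x y. \<lbrakk>x \<in> M; y \<in> M; d x y < (1/2)^n\<rbrakk> \<Longrightarrow> E n x y"
    "\<And>n x y. \<lbrakk>x \<in> M; y \<in> M; E n x y\<rbrakk> \<Longrightarrow> d x y \<le> (1/2)^n"
proof -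
  define f where "f x y = Inf {(1/2::real)^n |n. E n x y}" for x y
  have ne: "{(1/2::real)^n |n. E n x y} \<noteq> {}" for x y
    using E0 by blast
  have bdd: "bdd_below {(1/2::real)^n |n. E n x y}" for x y
    by (rule bdd_belowI[of _ 0]) auto
  have f0: "0 \<le> f x y" for x y
    unfolding f_def by (rule cInf_greatest[OF ne]) auto
  have f_le: "f x y \<le> (1/2)^n" if "E n x y" for n x y
    unfolding f_def by (rule cInf_lower[OF _ bdd]) (use that in auto)
  have monoI: "E n x y" if "E (n + k) x y" "x \<in> M" "y \<in> M" for n k x y
    using that by (induction k) (auto intro: mono)
  \<comment> \<open>Weights are infima of powers of 1/2, so a strict bound gains one index. This
    pays for the middle edge of a cut chain, which may carry the whole weight, while halving gains
    the same index for the two ends.\<close>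
  have small: "E (Suc n) x y" if lt: "f x y < (1/2)^n" and xy: "x \<in> M" "y \<in> M" for n x y
  proof -
    obtain m where m: "E m x y" "(1/2::real)^m < (1/2)^n"
      using lt unfolding f_def cInf_less_iff[OF ne bdd] by auto
    then have "n < m"
      by (simp add: power_strict_decreasing_iff)
    then show ?thesis
      using monoI[of "Suc n" "m - Suc n" x y] m xy by simp
  qed
  have fsym: "f x y = f y x" for x y
  proof -
    have "E n x y = E n y x" for n
      using sym by blast
    then show ?thesis
      unfolding f_def by simp
  qed
  \<comment> \<open>The value 0 off \<open>M\<close> serves the nonnegativity and symmetry axioms of
    \<open>Metric_space\<close>, which range over all points.\<close>
  define d where "d x y = (if x \<in> M \<and> y \<in> M then Inf {r. \<exists>n. weighted_chain M f n x y r} else 0)" for x y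
  have dne: "{r. \<exists>n. weighted_chain M f n x y r} \<noteq> {}" if "x \<in> M" "y \<in> M" for x y
    using weighted_chain_single[OF that, of f] by auto
  have dbdd: "bdd_below {r. \<exists>n. weighted_chain M f n x y r}" for x y
    by (rule bdd_belowI[of _ 0]) (use weighted_chain_nonneg[of f M, OF f0] in blast)
  have d_le: "d x y \<le> r" if "weighted_chain M f n x y r" for n x y r
  proof -
    have "Inf {r. \<exists>n. weighted_chain M f n x y r} \<le> r"
      by (rule cInf_lower[OF _ dbdd]) (use that in blast)
    then show ?thesis
      unfolding d_def using weighted_chain_in[OF that] by simp
  qed
  have d_less: "\<exists>n r. weighted_chain M f n x y r \<and> r < t" if "d x y < t" "x \<in> M" "y \<in> M" for x y t
  proof -
    have "Inf {r. \<exists>n. weighted_chain M f n x y r} < t"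
      using that unfolding d_def by simp
    then show ?thesis
      using cInf_less_iff[OF dne dbdd, of x y t] that by blast
  qed
  have dE: "E n x y" if xyM: "x \<in> M" "y \<in> M" "d x y < (1/2)^n" for n x y
  proof -
    obtain k r where "weighted_chain M f k x y r" "r < (1/2)^n"
      using d_less[OF xyM(3,1,2)] by blast
    then show ?thesis
      by (rule weighted_chain_entourage[of f M E, rotated -2]) (fact f0 refl triple small)+
  qed
  have Ed: "d x y \<le> (1/2)^n" if "x \<in> M" "y \<in> M" "E n x y" for n x y
    using d_le[OF weighted_chain_single[OF that(1,2)]] f_le[OF that(3)] by linarith
  have "Metric_space M d"
  proof
    show nn: "0 \<le> d x y" for x y
    proof -
      have "0 \<le> Inf {r. \<exists>n. weighted_chain M f n x y r}" if "x \<in> M" "y \<in> M"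
        using weighted_chain_nonneg[of f M, OF f0] by (intro cInf_greatest dne that) blast
      then show ?thesis
        by (simp add: d_def)
    qed
    show "d x y = d y x" for x y
    proof -
      have "weighted_chain M f n x y r = weighted_chain M f n y x r" for n r
        using weighted_chain_sym[of f M] fsym by blast
      then show ?thesis
        unfolding d_def by auto
    qed
    show "(d x y = 0) = (x = y)" if "x \<in> M" "y \<in> M" for x y
    proof
      assume "d x y = 0"
      then have "E n x y" for n
        using dE that by simp
      then show "x = y"
        using sep that by blast
    next
      assume "x = y"
      then show "d x y = 0"
        using d_le[OF weighted_chain.refl[of x M f]] that nn[of x y] by force
    qed
    show "d x z \<le> d x y + d y z" if xyz: "x \<in> M" "y \<in> M" "z \<in> M" for x y z
    proof (rule field_le_epsilon)
      fix e :: real assume "0 < e"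
      then obtain n r m s where "weighted_chain M f n x y r" "r < d x y + e/2"
        "weighted_chain M f m y z s" "s < d y z + e/2"
        using d_less[of x y "d x y + e/2"] d_less[of y z "d y z + e/2"] xyz by auto
      moreover from this have "d x z \<le> r + s"
        by (blast intro: d_le weighted_chain_trans)
      ultimately show "d x z \<le> d x y + d y z + e"
        by linarith
    qed
  qed
  then show ?thesis
    using that dE Ed by blast
qed

proposition entourage_metric:
  fixes F :: "nat \<Rightarrow> 'a \<Rightarrow> 'a \<Rightarrow> bool"
  assumes refl: "\<And>n x. x \<in> M \<Longrightarrow> F n x x"
    and sym: "\<And>n x y. F n x y \<Longrightarrow> F n y x"
    and comp: "\<And>n x y z. \<lbrakk>F (Suc n) x y; F (Suc n) y z; x \<in> M; y \<in> M; z \<in> M\<rbrakk> \<Longrightarrow> F n x z"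
    and sep: "\<And>x y. \<lbrakk>x \<in> M; y \<in> M; \<And>n. F n x y\<rbrakk> \<Longrightarrow> x = y"
  obtains d where "Metric_space M d"
    "\<And>n. \<exists>\<epsilon>>0. \<forall>x\<in>M. \<forall>y\<in>M. d x y < \<epsilon> \<longrightarrow> F n x y"
    "\<And>\<epsilon>. 0 < \<epsilon> \<Longrightarrow> \<exists>n. \<forall>x\<in>M. \<forall>y\<in>M. F n x y \<longrightarrow> d x y < \<epsilon>"
proof -
  \<comment> \<open>The chain metric composes three edges at once and wants a trivial level 0. Every
    second \<open>F\<close> provides this, since two successive compositions absorb three
    edges.\<close>
  define E where "E n = (case n of 0 \<Rightarrow> \<lambda>_ _. True | Suc m \<Rightarrow> F (2 * m))" for n
  have mono: "F n x y" if "F (Suc n) x y" "x \<in> M" "y \<in> M" for n x y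
    using comp[OF that(1) refl] that by blast
  have EF: "E (Suc n) x y = F (2 * n) x y" "E 0 x y" for n x y
    by (auto simp: E_def)
  obtain d where d: "Metric_space M d"
    "\<And>n x y. \<lbrakk>x \<in> M; y \<in> M; d x y < (1/2)^n\<rbrakk> \<Longrightarrow> E n x y"
    "\<And>n x y. \<lbrakk>x \<in> M; y \<in> M; E n x y\<rbrakk> \<Longrightarrow> d x y \<le> (1/2)^n"
  proof (rule entourage_metric_triple[of E M])
    show "E n x y" if "E (Suc n) x y" "x \<in> M" "y \<in> M" for n x y
      using that by (cases n) (auto simp: EF intro: mono)
    show "E n w z" if "E (Suc n) w x" "E (Suc n) x y" "E (Suc n) y z"
      "w \<in> M" "x \<in> M" "y \<in> M" "z \<in> M" for n w x y z
    proof (cases n)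
      case (Suc m)
      then have "F (Suc (Suc (2*m))) w x" "F (Suc (Suc (2*m))) x y" "F (Suc (Suc (2*m))) y z"
        using that EF by auto
      then have "F (Suc (2*m)) w y" "F (Suc (2*m)) y z"
        using comp mono that by blast+
      then show ?thesis
        using comp that EF Suc by blast
    qed (simp add: EF)
    show "x = y" if "x \<in> M" "y \<in> M" "\<And>n. E n x y" for x y
    proof (rule sep[OF that(1,2)])
      fix n
      have "F (n + k) x y \<Longrightarrow> F n x y" for k
        using mono that by (induction k) auto
      then show "F n x y"
        using that(3)[of "Suc n"] EF by (metis mult_2)
    qed
  qed (auto simp: E_def refl split: nat.splits intro: sym)
  show ?thesis
  proof (rule that[OF d(1)])
    fix n
    have "F n x y" if "d x y < (1/2)^(Suc n)" "x \<in> M" "y \<in> M" for x y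
    proof -
      have "F (n + k) x y \<Longrightarrow> F n x y" for k
        using mono that by (induction k) auto
      then show ?thesis
        using d(2)[of x y "Suc n"] that EF by (metis mult_2)
    qed
    then show "\<exists>\<epsilon>>0. \<forall>x\<in>M. \<forall>y\<in>M. d x y < \<epsilon> \<longrightarrow> F n x y"
      by (intro exI[of _ "(1/2)^(Suc n)"]) auto
  next
    fix \<epsilon> :: real assume "0 < \<epsilon>"
    then obtain n where n: "(1/2)^n < \<epsilon>"
      using real_arch_pow_inv[of \<epsilon> "1/2"] by auto
    have "(1/2::real)^(Suc n) \<le> (1/2)^n" by simp
    then have "d x y < \<epsilon>" if "F (2*n) x y" "x \<in> M" "y \<in> M" for x y
      using d(3)[of x y "Suc n"] that EF(1)[of n x y] n by linarith
    then show "\<exists>n. \<forall>x\<in>M. \<forall>y\<in>M. F n x y \<longrightarrow> d x y < \<epsilon>"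
      by blast
  qed
qed

subsection \<open>Rectified sequential spaces\<close>

text \<open>Applied to the code, the row and the column of a pair, this reduces a sequence in a
  doubly indexed family to indices that are constant or strictly increasing. If no value recurs
  infinitely often, only finitely many later values can lie below a given one.\<close>

lemma nat_sequence_constant_or_strict_mono:
  fixes g :: "nat \<Rightarrow> nat"
  shows "(\<exists>v. \<exists>r::nat \<Rightarrow> nat. strict_mono r \<and> (\<forall>n. g (r n) = v)) \<or>
    (\<exists>r::nat \<Rightarrow> nat. strict_mono r \<and> strict_mono (g \<circ> r))"
proof (cases "\<exists>v. infinite {n. g n = v}")
  case True
  then obtain v where "infinite {n. g n = v}" by blast
  then obtain r :: "nat \<Rightarrow> nat" where "strict_mono r" "\<And>n. g (r n) = v"
    using infinite_enumerate[of "{n. g n = v}"] by auto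
  then show ?thesis
    by blast
next
  case False
  have "\<exists>m. n < m \<and> g n < g m" for n
  proof (rule ccontr)
    assume "\<not> ?thesis"
    then have "{n<..} \<subseteq> (\<Union>v\<in>{..g n}. {m. g m = v})"
      by auto
    moreover have "finite (\<Union>v\<in>{..g n}. {m. g m = v})"
      using False by simp
    ultimately show False
      using finite_subset infinite_Ioi by blast
  qed
  then obtain s where s: "\<And>n. n < s n" "\<And>n. g n < g (s n)" by metis
  define r where "r = rec_nat 0 (\<lambda>_. s)"
  have "r (Suc n) = s (r n)" for n
    by (simp add: r_def)
  then have "strict_mono r" "strict_mono (g \<circ> r)"
    using s by (auto simp: strict_mono_Suc_iff)
  then show ?thesis by blast
qed

lemma sequential_closedinI:
  assumes "sequential_space X" "A \<subseteq> topspace X"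
    and "\<And>\<sigma> l. \<lbrakk>range \<sigma> \<subseteq> A; limitin X \<sigma> l sequentially\<rbrakk> \<Longrightarrow> l \<in> A"
  shows "closedin X A"
  using assms unfolding sequential_space_def by blast

lemma closedin_limit_mem:
  assumes "closedin X A" "limitin X \<sigma> l sequentially" "\<And>n. \<sigma> n \<in> A"
  shows "l \<in> A"
  using limitin_closedin[OF assms(2,1)] assms(3) by simp

lemma not_eventually_subseq:
  assumes "\<not> eventually P sequentially"
  obtains r :: "nat \<Rightarrow> nat" where "strict_mono r" "\<And>n. \<not> P (r n)"
proof -
  have "infinite {n. \<not> P n}"
    using assms by (simp add: cofinite_eq_sequentially[symmetric] eventually_cofinite)
  then show ?thesis
    using infinite_enumerate[of "{n. \<not> P n}"] that by auto
qed

lemma eventually_all_atMost: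
  fixes N :: nat
  assumes "\<And>i. i \<le> N \<Longrightarrow> eventually (P i) F"
  shows "eventually (\<lambda>x. \<forall>i\<le>N. P i x) F"
  using assms eventually_ball_finite_distrib[of "{..N}" "\<lambda>x i. P i x" F] by (simp add: Ball_def)

section \<open>Sequentially compact subsets\<close>

definition seq_compactin :: "'a topology \<Rightarrow> 'a set \<Rightarrow> bool" where
  "seq_compactin X K \<longleftrightarrow> K \<subseteq> topspace X \<and>
     (\<forall>\<sigma>::nat \<Rightarrow> 'a. range \<sigma> \<subseteq> K \<longrightarrow> (\<exists>l\<in>K. \<exists>r::nat \<Rightarrow> nat. strict_mono r \<and> limitin X (\<sigma> \<circ> r) l sequentially))"

lemma seq_compactin_subset: "seq_compactin X K \<Longrightarrow> K \<subseteq> topspace X"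
  by (simp add: seq_compactin_def)

lemma seq_compactinE:
  assumes "seq_compactin X K" "\<And>n. \<sigma> n \<in> K"
  obtains l and r :: "nat \<Rightarrow> nat" where "l \<in> K" "strict_mono r" "limitin X (\<lambda>n. \<sigma> (r n)) l sequentially"
proof -
  have "range \<sigma> \<subseteq> K" using assms(2) by auto
  then show ?thesis
    using assms(1) that unfolding seq_compactin_def o_def by blast
qed

text \<open>\<open>p\<close> and \<open>q\<close> stand for the second coordinates of a rectifying
  homeomorphism \<open>h\<close> and of its inverse; \<open>p_e\<close> is the condition
  \<open>h (x, e) = (x, x)\<close>.\<close>

locale rectified_space =
  fixes X :: "'a topology" and e :: 'a and p q :: "'a \<Rightarrow> 'a \<Rightarrow> 'a"
  assumes regular: "regular_space X" and t1: "t1_space X" and sequential: "sequential_space X"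
    and e_in: "e \<in> topspace X"
    and continuous_p: "continuous_map (prod_topology X X) X (\<lambda>(x, y). p x y)"
    and continuous_q: "continuous_map (prod_topology X X) X (\<lambda>(x, y). q x y)"
    and p_e: "x \<in> topspace X \<Longrightarrow> p x e = x"
    and p_q: "\<lbrakk>x \<in> topspace X; y \<in> topspace X\<rbrakk> \<Longrightarrow> p x (q x y) = y"
    and q_p: "\<lbrakk>x \<in> topspace X; y \<in> topspace X\<rbrakk> \<Longrightarrow> q x (p x y) = y"
begin

lemma Hausdorff: "Hausdorff_space X"
  using regular t1 regular_t1_imp_Hausdorff_space by blast

lemma limit_unique:
  "\<lbrakk>limitin X \<sigma> l sequentially; limitin X \<sigma> l' sequentially\<rbrakk> \<Longrightarrow> l = l'"
  by (rule limitin_Hausdorff_unique[of X \<sigma> l sequentially l']) (simp_all add: Hausdorff)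

lemma limit_subseq:
  "\<lbrakk>limitin X \<sigma> l sequentially; strict_mono r\<rbrakk> \<Longrightarrow> limitin X (\<lambda>n. \<sigma> (r n)) l sequentially"
  using limitin_subsequence[of r X \<sigma> l] by (simp add: o_def)

lemma closedin_singleton: "x \<in> topspace X \<Longrightarrow> closedin X {x}"
  by (rule closedin_t1_singleton[OF t1])

lemma openin_delete: "openin X U \<Longrightarrow> openin X (U - {x})"
  using t1 unfolding t1_space_openin_delete_alt by blast

lemma shrink:
  assumes "openin X U" "x \<in> U"
  obtains V C where "openin X V" "closedin X C" "x \<in> V" "V \<subseteq> C" "C \<subseteq> U"
  using assms regular by (metis neighbourhood_base_of neighbourhood_base_of_closedin)

lemma p_in: "\<lbrakk>x \<in> topspace X; y \<in> topspace X\<rbrakk> \<Longrightarrow> p x y \<in> topspace X"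
  using continuous_map_image_subset_topspace[OF continuous_p] by fastforce

lemma q_in: "\<lbrakk>x \<in> topspace X; y \<in> topspace X\<rbrakk> \<Longrightarrow> q x y \<in> topspace X"
  using continuous_map_image_subset_topspace[OF continuous_q] by fastforce

lemma q_self: "x \<in> topspace X \<Longrightarrow> q x x = e"
  using q_p[OF _ e_in] p_e by fastforce

lemma q_eq_e: "\<lbrakk>x \<in> topspace X; y \<in> topspace X; q x y = e\<rbrakk> \<Longrightarrow> x = y"
  using p_q p_e by metis

lemma limit_p:
  assumes "limitin X u x F" "limitin X v y F"
  shows "limitin X (\<lambda>n. p (u n) (v n)) (p x y) F"
proof -
  have "limitin (prod_topology X X) (\<lambda>n. (u n, v n)) (x, y) F"
    using assms by (simp add: limitin_pairwise o_def)
  from continuous_map_limit[OF continuous_p this] show ?thesis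
    by (simp add: o_def)
qed

lemma limit_q:
  assumes "limitin X u x F" "limitin X v y F"
  shows "limitin X (\<lambda>n. q (u n) (v n)) (q x y) F"
proof -
  have "limitin (prod_topology X X) (\<lambda>n. (u n, v n)) (x, y) F"
    using assms by (simp add: limitin_pairwise o_def)
  from continuous_map_limit[OF continuous_q this] show ?thesis
    by (simp add: o_def)
qed

lemma limit_const: "x \<in> topspace X \<Longrightarrow> limitin X (\<lambda>_. x) x F"
  by (simp add: Abstract_Limits.limitin_const_iff)

lemma p_nhd:
  assumes "openin X W" "x \<in> topspace X" "y \<in> topspace X" "p x y \<in> W"
  obtains U V where "openin X U" "openin X V" "x \<in> U" "y \<in> V" "\<And>u v. \<lbrakk>u \<in> U; v \<in> V\<rbrakk> \<Longrightarrow> p u v \<in> W"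
proof -
  define S where "S = {z \<in> topspace (prod_topology X X). (\<lambda>(x, y). p x y) z \<in> W}"
  have "openin (prod_topology X X) S"
    unfolding S_def by (rule openin_continuous_map_preimage[OF continuous_p assms(1)])
  moreover have "(x, y) \<in> S"
    using assms by (simp add: S_def)
  ultimately have "\<exists>U. openin X U \<and> (\<exists>V. openin X V \<and> x \<in> U \<and> y \<in> V \<and> U \<times> V \<subseteq> S)"
    by (simp add: openin_prod_topology_alt)
  then obtain U V where UV: "openin X U" "openin X V" "x \<in> U" "y \<in> V" "U \<times> V \<subseteq> S"
    by auto
  show ?thesis
  proof (rule that[OF UV(1-4)])
    fix u v assume "u \<in> U" "v \<in> V"
    then have "(u, v) \<in> S"
      using UV(5) by blast
    then show "p u v \<in> W"
      by (simp add: S_def)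
  qed
qed

lemma p_nhd_e:
  assumes "openin X W" "x \<in> W"
  obtains U V where "openin X U" "openin X V" "x \<in> U" "e \<in> V" "\<And>u v. \<lbrakk>u \<in> U; v \<in> V\<rbrakk> \<Longrightarrow> p u v \<in> W"
proof -
  have x: "x \<in> topspace X"
    using assms openin_subset by blast
  show ?thesis
    using p_nhd[OF assms(1) x e_in] assms p_e[OF x] that by metis
qed

lemma seq_compactin_closedin:
  assumes "seq_compactin X K"
  shows "closedin X K"
proof (rule sequential_closedinI[OF sequential])
  show "K \<subseteq> topspace X"
    by (rule seq_compactin_subset[OF assms])
  fix \<sigma> l assume *: "range \<sigma> \<subseteq> K" "limitin X \<sigma> l sequentially"
  then have "\<sigma> n \<in> K" for n
    by blast
  then obtain l' r where "l' \<in> K" "strict_mono r" "limitin X (\<lambda>n. \<sigma> (r n)) l' sequentially"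
    by (rule seq_compactinE[OF assms])
  then show "l \<in> K"
    using limit_unique[OF limit_subseq[OF *(2)]] by simp
qed

lemma seq_compactin_image2:
  assumes K: "seq_compactin X K" and L: "seq_compactin X L"
    and f: "\<And>u v x y. \<lbrakk>limitin X u x sequentially; limitin X v y sequentially\<rbrakk> \<Longrightarrow>
        limitin X (\<lambda>n. f (u n) (v n)) (f x y) sequentially"
    and in_X: "\<And>x y. \<lbrakk>x \<in> topspace X; y \<in> topspace X\<rbrakk> \<Longrightarrow> f x y \<in> topspace X"
  shows "seq_compactin X (case_prod f ` (K \<times> L))"
  unfolding seq_compactin_def
proof (intro conjI allI impI)
  have "K \<subseteq> topspace X" "L \<subseteq> topspace X"
    using seq_compactin_subset[OF K] seq_compactin_subset[OF L] .
  then show "case_prod f ` (K \<times> L) \<subseteq> topspace X"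
    using in_X by auto
  fix \<sigma> :: "nat \<Rightarrow> 'a" assume rng: "range \<sigma> \<subseteq> case_prod f ` (K \<times> L)"
  have "\<forall>n. \<exists>x y. x \<in> K \<and> y \<in> L \<and> \<sigma> n = f x y"
  proof
    fix n
    from rng have "\<sigma> n \<in> case_prod f ` (K \<times> L)"
      by (rule range_subsetD)
    then show "\<exists>x y. x \<in> K \<and> y \<in> L \<and> \<sigma> n = f x y"
      by auto
  qed
  then obtain u v where uv: "\<And>n. u n \<in> K" "\<And>n. v n \<in> L" "\<And>n. \<sigma> n = f (u n) (v n)"
    by metis
  obtain x r where x: "x \<in> K" "strict_mono r" "limitin X (\<lambda>n. u (r n)) x sequentially"
    using seq_compactinE[OF K, of u, OF uv(1)] by metis
  obtain y s where y: "y \<in> L" "strict_mono s" "limitin X (\<lambda>n. v (r (s n))) y sequentially"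
    using seq_compactinE[OF L, of "\<lambda>n. v (r n)", OF uv(2)] by metis
  have "limitin X (\<lambda>n. f (u (r (s n))) (v (r (s n)))) (f x y) sequentially"
    by (rule f[OF limit_subseq[OF x(3) y(2)] y(3)])
  then have "limitin X (\<sigma> \<circ> (r \<circ> s)) (f x y) sequentially"
    using uv by (simp add: o_def)
  moreover have "strict_mono (r \<circ> s)"
    by (rule strict_mono_o[OF x(2) y(2)])
  moreover have "f x y \<in> case_prod f ` (K \<times> L)"
    using x(1) y(1) by force
  ultimately show "\<exists>l\<in>case_prod f ` (K \<times> L). \<exists>r. strict_mono r \<and> limitin X (\<sigma> \<circ> r) l sequentially"
    by blast
qed

lemmas seq_compactin_p = seq_compactin_image2[OF _ _ limit_p p_in]
lemmas seq_compactin_q = seq_compactin_image2[OF _ _ limit_q q_in]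

section \<open>Sequential barriers and diagonalization of sheaves\<close>

definition seq_barrier :: "'a set \<Rightarrow> 'a \<Rightarrow> 'a set \<Rightarrow> bool" where
  "seq_barrier L z M \<longleftrightarrow>
     (\<forall>\<sigma>. range \<sigma> \<subseteq> L \<and> limitin X \<sigma> z sequentially \<longrightarrow> (\<forall>\<^sub>F n in sequentially. \<sigma> n \<in> M))"

text \<open>This is Arhangel'skii's property alpha_4 at \<open>e\<close>, restricted to sequences in
  \<open>L\<close>: one term from each of infinitely many rows can be chosen so that the chosen
  terms still tend to \<open>e\<close>.\<close>

definition diagonal_at_e :: "'a set \<Rightarrow> bool" where
  "diagonal_at_e L \<longleftrightarrow>
     (\<forall>\<sigma> :: nat \<Rightarrow> nat \<Rightarrow> 'a. (\<forall>n. range (\<sigma> n) \<subseteq> L \<and> limitin X (\<sigma> n) e sequentially) \<longrightarrow>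
        (\<exists>r k. strict_mono r \<and> limitin X (\<lambda>n. \<sigma> (r n) (k n)) e sequentially))"

lemma diagonal_at_eE:
  fixes \<sigma> :: "nat \<Rightarrow> nat \<Rightarrow> 'a"
  assumes "diagonal_at_e L" "\<And>n. range (\<sigma> n) \<subseteq> L" "\<And>n. limitin X (\<sigma> n) e sequentially"
  obtains r k :: "nat \<Rightarrow> nat" where "strict_mono r" "limitin X (\<lambda>n. \<sigma> (r n) (k n)) e sequentially"
proof -
  have "\<exists>r k. strict_mono r \<and> limitin X (\<lambda>n. \<sigma> (r n) (k n)) e sequentially"
    using assms(1)[unfolded diagonal_at_e_def, rule_format, of \<sigma>] assms(2,3) by simp
  then show ?thesis
    using that by auto
qed

text \<open>Translating by the limits turns a sheaf of second-order sequences into sequences converging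
  to e, so the diagonal property makes sequential closure idempotent.\<close>
lemma seq_barrier_nhd:
  assumes diag: "diagonal_at_e (topspace X)" and z: "z \<in> topspace X"
    and M: "seq_barrier (topspace X) z M"
  obtains U where "openin X U" "z \<in> U" "U \<subseteq> M"
proof -
  define A where "A = topspace X - M"
  \<comment> \<open>The sequential closure of the complement of \<open>M\<close> in one step. Once
    it is known to be closed, its complement is the wanted neighbourhood, and the barrier property
    keeps \<open>z\<close> out of it.\<close>
  define B where "B = {x. \<exists>\<sigma>. range \<sigma> \<subseteq> A \<and> limitin X \<sigma> x sequentially}"
  have "closedin X B"
  proof (rule sequential_closedinI[OF sequential])
    show "B \<subseteq> topspace X"
      unfolding B_def using limitin_topspace by fast
    fix y l assume y: "range y \<subseteq> B" "limitin X y l sequentially"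
    then have "\<forall>n. \<exists>\<sigma>. range \<sigma> \<subseteq> A \<and> limitin X \<sigma> (y n) sequentially"
      unfolding B_def by blast
    then obtain s where s: "\<And>n. range (s n) \<subseteq> A" "\<And>n. limitin X (s n) (y n) sequentially"
      by metis
    have yX: "y n \<in> topspace X" for n
      using s limitin_topspace by fast
    have sX: "s n k \<in> topspace X" for n k
      using s unfolding A_def by fast
    define t where "t n k = q (y n) (s n k)" for n k
    have "limitin X (t n) e sequentially" for n
      using limit_q[OF limit_const[OF yX] s(2), of n n] q_self[OF yX] unfolding t_def by simp
    moreover have "range (t n) \<subseteq> topspace X" for n
      using q_in yX sX by (auto simp: t_def)
    ultimately obtain r k where rk: "strict_mono r" "limitin X (\<lambda>n. t (r n) (k n)) e sequentially"
      using diagonal_at_eE[OF diag, of t] by metis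
    have "limitin X (\<lambda>n. p (y (r n)) (t (r n) (k n))) (p l e) sequentially"
      by (rule limit_p[OF limit_subseq[OF y(2) rk(1)] rk(2)])
    moreover have "p (y (r n)) (t (r n) (k n)) = s (r n) (k n)" for n
      using p_q yX sX by (simp add: t_def)
    moreover have "p l e = l"
      using p_e y limitin_topspace by fast
    ultimately have "limitin X (\<lambda>n. s (r n) (k n)) l sequentially"
      by simp
    moreover have "range (\<lambda>n. s (r n) (k n)) \<subseteq> A"
      using s by blast
    ultimately show "l \<in> B"
      unfolding B_def by blast
  qed
  moreover have "A \<subseteq> B"
  proof
    fix x assume "x \<in> A"
    then have "limitin X (\<lambda>_. x) x sequentially" "range (\<lambda>_::nat. x) \<subseteq> A"
      using limit_const unfolding A_def by auto
    then show "x \<in> B"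
      unfolding B_def by blast
  qed
  moreover have "z \<notin> B"
  proof
    assume "z \<in> B"
    then obtain \<sigma> where \<sigma>: "range \<sigma> \<subseteq> A" "limitin X \<sigma> z sequentially"
      unfolding B_def by blast
    then have "\<forall>\<^sub>F n in sequentially. \<sigma> n \<in> M"
      using M unfolding seq_barrier_def A_def by blast
    then show False
      using \<sigma> unfolding A_def eventually_sequentially by blast
  qed
  ultimately show ?thesis
    using that[of "topspace X - B"] z unfolding A_def by blast
qed

end

text \<open>Closure under unions lets the members inside a given neighbourhood be replaced by an
  increasing sequence of members; closedness makes membership pass to limits.\<close>

locale cs_rectified_space = rectified_space +
  fixes \<N> :: "'a set set"
  assumes countable_network: "countable \<N>"
    and closed_network: "N \<in> \<N> \<Longrightarrow> closedin X N"
    and e_in_network: "N \<in> \<N> \<Longrightarrow> e \<in> N"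
    and network_Un: "\<lbrakk>M \<in> \<N>; N \<in> \<N>\<rbrakk> \<Longrightarrow> M \<union> N \<in> \<N>"
    and network: "\<lbrakk>openin X U; e \<in> U; limitin X \<sigma> e sequentially\<rbrakk> \<Longrightarrow>
        \<exists>N\<in>\<N>. N \<subseteq> U \<and> (\<forall>\<^sub>F n in sequentially. \<sigma> n \<in> N)"
begin

text \<open>The members are closures of (a N) N': choose a in the given set close to x, N absorbing the
  quotient of x by a, and N' absorbing the quotients of the sequence by x.\<close>
lemma countable_closed_cs_network:
  assumes Q: "countable Q" "Q \<subseteq> topspace X"
  obtains \<P> where "countable \<P>" "\<And>P. P \<in> \<P> \<Longrightarrow> closedin X P"
    "\<And>a x U. \<lbrakk>range a \<subseteq> Q; limitin X a x sequentially; openin X U; x \<in> U\<rbrakk> \<Longrightarrow>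
        \<exists>P\<in>\<P>. P \<subseteq> U \<and> (\<forall>\<^sub>F n in sequentially. a n \<in> P)"
proof
  define R where "R = (\<lambda>(a, M, N). X closure_of (case_prod p ` ((p a ` M) \<times> N)))"
  show "countable (R ` (Q \<times> \<N> \<times> \<N>))"
    using Q countable_network by blast
  show "closedin X P" if "P \<in> R ` (Q \<times> \<N> \<times> \<N>)" for P
    using that unfolding R_def by auto
  fix a x U assume a: "range a \<subseteq> Q" "limitin X a x sequentially" and U: "openin X U" "x \<in> U"
  have xX: "x \<in> topspace X" and aX: "a n \<in> topspace X" for n
    using a Q limitin_topspace by fast+
  obtain V C where V: "openin X V" "closedin X C" "x \<in> V" "V \<subseteq> C" "C \<subseteq> U"
    using shrink[OF U] by blast
  obtain W1 O1 where W1: "openin X W1" "openin X O1" "x \<in> W1" "e \<in> O1"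
    "\<And>u v. \<lbrakk>u \<in> W1; v \<in> O1\<rbrakk> \<Longrightarrow> p u v \<in> V"
    using p_nhd_e[OF V(1,3)] by metis
  obtain W2 O2 where W2: "openin X W2" "openin X O2" "x \<in> W2" "e \<in> O2"
    "\<And>u v. \<lbrakk>u \<in> W2; v \<in> O2\<rbrakk> \<Longrightarrow> p u v \<in> W1"
    using p_nhd_e[OF W1(1,3)] by metis
  have "limitin X (\<lambda>n. q x (a n)) e sequentially" "limitin X (\<lambda>n. q (a n) x) e sequentially"
    using limit_q[OF limit_const[OF xX] a(2)] limit_q[OF a(2) limit_const[OF xX]] q_self[OF xX] by auto
  then obtain M N where N: "N \<in> \<N>" "N \<subseteq> O1" "\<forall>\<^sub>F n in sequentially. q x (a n) \<in> N"
    and M: "M \<in> \<N>" "M \<subseteq> O2" "\<forall>\<^sub>F n in sequentially. q (a n) x \<in> M"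
    using network W1 W2 by metis
  have "\<forall>\<^sub>F n in sequentially. a n \<in> W2"
    using a(2) W2 by (simp add: limitinD)
  then have "\<forall>\<^sub>F n in sequentially. a n \<in> W2 \<and> q (a n) x \<in> M"
    using M(3) by eventually_elim auto
  then obtain m where m: "a m \<in> W2" "q (a m) x \<in> M"
    by (auto simp: eventually_sequentially)
  define P where "P = R (a m, M, N)"
  define B where "B = case_prod p ` ((p (a m) ` M) \<times> N)"
  have P: "P = X closure_of B"
    by (simp add: P_def R_def B_def)
  have "B \<subseteq> V"
    using m M(2) N(2) W1(5) W2(5) by (auto simp: B_def subset_iff)
  then have "B \<subseteq> topspace X" "B \<subseteq> C"
    using V openin_subset[OF V(1)] by auto
  then have "P \<subseteq> C" "B \<subseteq> P"
    unfolding P using V by (simp_all add: closure_of_minimal closure_of_subset)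
  have "\<forall>\<^sub>F n in sequentially. a n \<in> P"
    using N(3)
  proof eventually_elim
    case (elim n)
    \<comment> \<open>The left factor \<open>p (a m) (q (a m) x)\<close> equals \<open>x\<close>.
      Reaching the limit through a term of \<open>a\<close> keeps the index set countable, although
      the possible limits \<open>x\<close> need not form a countable set.\<close>
    have "a n = p (p (a m) (q (a m) x)) (q x (a n))"
      using p_q aX xX by simp
    then have "a n \<in> B"
      unfolding B_def using elim m by (metis SigmaI imageI case_prod_conv)
    then show ?case
      using \<open>B \<subseteq> P\<close> by blast
  qed
  moreover have "P \<in> R ` (Q \<times> \<N> \<times> \<N>)"
    unfolding P_def using a M N by blast
  ultimately show "\<exists>P\<in>R ` (Q \<times> \<N> \<times> \<N>). P \<subseteq> U \<and> (\<forall>\<^sub>F n in sequentially. a n \<in> P)"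
    using V \<open>P \<subseteq> C\<close> by blast
qed

text \<open>If every member inside \<open>U\<close> failed, the growing finite unions
  \<open>G n\<close> of such members, being members themselves, would each be missed by some
  sequence in \<open>L\<close> tending to \<open>e\<close>. A diagonal of these sequences is
  eventually absorbed by a single member, which is part of all late \<open>G n\<close>.\<close>

lemma exists_seq_barrier:
  assumes diag: "diagonal_at_e L" and U: "openin X U" "e \<in> U"
  shows "\<exists>M\<in>\<N>. M \<subseteq> U \<and> seq_barrier L e M"
proof (rule ccontr)
  assume "\<not> ?thesis"
  then have none: "\<not> seq_barrier L e M" if "M \<in> \<N>" "M \<subseteq> U" for M
    using that by blast
  define \<M> where "\<M> = {M \<in> \<N>. M \<subseteq> U}"
  have "countable \<M>"
    unfolding \<M>_def using countable_network by simp
  moreover have "\<M> \<noteq> {}"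
    unfolding \<M>_def using network[OF U limit_const[OF e_in]] by blast
  ultimately have rng: "range (from_nat_into \<M>) = \<M>"
    by simp
  define G where "G n = (\<Union>i\<le>n. from_nat_into \<M> i)" for n
  have "G n \<in> \<M>" for n
  proof (induction n)
    case 0
    then show ?case
      using rng by (auto simp: G_def)
  next
    case (Suc n)
    have "from_nat_into \<M> (Suc n) \<in> \<M>"
      using rng by auto
    moreover have "G (Suc n) = from_nat_into \<M> (Suc n) \<union> G n"
      by (auto simp: G_def atMost_Suc)
    ultimately show ?case
      using Suc network_Un unfolding \<M>_def by auto
  qed
  then have "\<not> seq_barrier L e (G n)" for n
    using none unfolding \<M>_def by blast
  then have "\<forall>n. \<exists>\<sigma>. range \<sigma> \<subseteq> L \<and> limitin X \<sigma> e sequentially \<and> (\<forall>k. \<sigma> k \<notin> G n)"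
  proof (intro allI)
    fix n
    obtain \<sigma> where \<sigma>: "range \<sigma> \<subseteq> L" "limitin X \<sigma> e sequentially"
      "\<not> (\<forall>\<^sub>F k in sequentially. \<sigma> k \<in> G n)"
      using \<open>\<not> seq_barrier L e (G n)\<close> unfolding seq_barrier_def by blast
    obtain r :: "nat \<Rightarrow> nat" where "strict_mono r" "\<And>k. \<sigma> (r k) \<notin> G n"
      using not_eventually_subseq[OF \<sigma>(3)] by metis
    then show "\<exists>\<sigma>. range \<sigma> \<subseteq> L \<and> limitin X \<sigma> e sequentially \<and> (\<forall>k. \<sigma> k \<notin> G n)"
      using \<sigma> limit_subseq[OF \<sigma>(2)] by (intro exI[of _ "\<lambda>k. \<sigma> (r k)"]) auto
  qed
  then obtain s where s: "\<And>n. range (s n) \<subseteq> L" "\<And>n. limitin X (s n) e sequentially"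
    "\<And>n k. s n k \<notin> G n"
    by metis
  then obtain r k where rk: "strict_mono r" "limitin X (\<lambda>n. s (r n) (k n)) e sequentially"
    using diagonal_at_eE[OF diag, of s] by metis
  then obtain N where "N \<in> \<N>" "N \<subseteq> U" and ev: "\<forall>\<^sub>F n in sequentially. s (r n) (k n) \<in> N"
    using network[OF U] by blast
  then have "N \<in> range (from_nat_into \<M>)"
    unfolding rng by (simp add: \<M>_def)
  then obtain i where i: "from_nat_into \<M> i = N"
    by (metis rangeE)
  obtain m where m: "\<And>n. n \<ge> m \<Longrightarrow> s (r n) (k n) \<in> N"
    using ev by (auto simp: eventually_sequentially)
  define n where "n = max m i"
  have "i \<le> r n"
    using seq_suble[OF rk(1), of n] unfolding n_def by simp
  then have "s (r n) (k n) \<in> G (r n)"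
    using m[of n] i unfolding G_def n_def by auto
  then show False
    using s by blast
qed

text \<open>From the n-th row a term is chosen outside the first members of a closed network that
  omit \<open>e\<close>. Sequential compactness gives a convergent subsequence of the chosen terms;
  a limit other than \<open>e\<close> would have a network member omitting \<open>e\<close> that
  absorbs the tail, against the choice.\<close>

lemma seq_compactin_diagonal:
  assumes L: "seq_compactin X L"
  shows "diagonal_at_e L"
  unfolding diagonal_at_e_def
proof (intro allI impI)
  fix s :: "nat \<Rightarrow> nat \<Rightarrow> 'a"
  assume s: "\<forall>n. range (s n) \<subseteq> L \<and> limitin X (s n) e sequentially"
  have LX: "L \<subseteq> topspace X"
    by (rule seq_compactin_subset[OF L])
  define Q where "Q = (\<Union>n. range (s n))"
  have "countable Q"
    unfolding Q_def by (intro countable_UN countable_image countableI_type)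
  moreover have "Q \<subseteq> topspace X"
    using s LX unfolding Q_def by blast
  ultimately obtain \<P> where \<P>: "countable \<P>" "\<And>P. P \<in> \<P> \<Longrightarrow> closedin X P"
    "\<And>a x U. \<lbrakk>range a \<subseteq> Q; limitin X a x sequentially; openin X U; x \<in> U\<rbrakk> \<Longrightarrow>
        \<exists>P\<in>\<P>. P \<subseteq> U \<and> (\<forall>\<^sub>F n in sequentially. a n \<in> P)"
    using countable_closed_cs_network[of Q] by metis
  \<comment> \<open>The empty set is added so that the family can be enumerated even when no member
    omits \<open>e\<close>.\<close>
  define \<P>' where "\<P>' = insert {} {P \<in> \<P>. e \<notin> P}"
  have rng: "range (from_nat_into \<P>') = \<P>'"
    unfolding \<P>'_def using \<P>(1) by simp
  have avoid: "\<forall>\<^sub>F k in sequentially. s n k \<notin> from_nat_into \<P>' i" for n i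
  proof -
    have "from_nat_into \<P>' i \<in> \<P>'"
      using rng by blast
    then have "closedin X (from_nat_into \<P>' i)" "e \<notin> from_nat_into \<P>' i"
      using \<P>(2) unfolding \<P>'_def by auto
    then have "\<forall>\<^sub>F k in sequentially. s n k \<in> topspace X - from_nat_into \<P>' i"
      using s e_in by (intro limitinD[of X "s n" e]) auto
    then show ?thesis
      by eventually_elim auto
  qed
  have "\<exists>k. \<forall>i\<le>n. s n k \<notin> from_nat_into \<P>' i" for n
  proof -
    have "\<forall>\<^sub>F k in sequentially. \<forall>i\<le>n. s n k \<notin> from_nat_into \<P>' i"
      by (rule eventually_all_atMost) (rule avoid)
    from eventually_happens[OF this] show ?thesis
      by simp
  qed
  then obtain k where k: "\<And>n i. i \<le> n \<Longrightarrow> s n (k n) \<notin> from_nat_into \<P>' i"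
    by metis
  have "s n (k n) \<in> L" for n
    using s by blast
  then obtain y r where y: "y \<in> L" "strict_mono r" "limitin X (\<lambda>n. s (r n) (k (r n))) y sequentially"
    by (rule seq_compactinE[OF L])
  have "y = e"
  proof (rule ccontr)
    assume "y \<noteq> e"
    then have U: "openin X (topspace X - {e})" "y \<in> topspace X - {e}"
      using y LX by (auto intro: openin_delete)
    have "range (\<lambda>n. s (r n) (k (r n))) \<subseteq> Q"
      unfolding Q_def by blast
    then obtain P where P: "P \<in> \<P>" "P \<subseteq> topspace X - {e}"
      "\<forall>\<^sub>F n in sequentially. s (r n) (k (r n)) \<in> P"
      using \<P>(3)[OF _ y(3) U] by blast
    then have "P \<in> range (from_nat_into \<P>')"
      unfolding rng by (auto simp: \<P>'_def)
    then obtain i where i: "from_nat_into \<P>' i = P"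
      by (metis rangeE)
    obtain m where m: "\<And>n. n \<ge> m \<Longrightarrow> s (r n) (k (r n)) \<in> P"
      using P(3) by (auto simp: eventually_sequentially)
    have "i \<le> r (max m i)"
      using seq_suble[OF y(2), of "max m i"] by simp
    then show False
      using k[of i "r (max m i)"] i m[of "max m i"] by simp
  qed
  then have "strict_mono r \<and> limitin X (\<lambda>n. s (r n) ((\<lambda>n. k (r n)) n)) e sequentially"
    using y by simp
  then show "\<exists>r k. strict_mono r \<and> limitin X (\<lambda>n. s (r n) (k n)) e sequentially"
    by (intro exI)
qed

end

subsection \<open>Sequentially compact sets and first countability\<close>

lemma topology_eqI_closedin:
  assumes "topspace X = topspace Y" "\<And>S. closedin X S \<longleftrightarrow> closedin Y S"
  shows "X = Y"
  unfolding topology_eq using assms by (simp add: openin_closedin_eq)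

context cs_rectified_space
begin

text \<open>The entourages are given by barriers relative to q(K x K); sequential compactness makes the
  composition condition uniform.\<close>
lemma seq_compactin_entourages:
  assumes K: "seq_compactin X K"
  obtains E :: "nat \<Rightarrow> 'a \<Rightarrow> 'a \<Rightarrow> bool" where
    "\<And>n x. x \<in> K \<Longrightarrow> E n x x" "\<And>n x y. E n x y \<Longrightarrow> E n y x"
    "\<And>n x y. E (Suc n) x y \<Longrightarrow> E n x y"
    "\<And>n. \<exists>m. \<forall>x\<in>K. \<forall>y\<in>K. \<forall>z\<in>K. E m x y \<longrightarrow> E m y z \<longrightarrow> E n x z"
    "\<And>x y. \<lbrakk>x \<in> K; y \<in> K; \<And>n. E n x y\<rbrakk> \<Longrightarrow> x = y"
    "\<And>n \<sigma> l. \<lbrakk>\<And>i. \<sigma> i \<in> K; l \<in> K; limitin X \<sigma> l sequentially\<rbrakk> \<Longrightarrow>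
       \<forall>\<^sub>F i in sequentially. E n (\<sigma> i) l"
proof -
  have KX: "x \<in> topspace X" if "x \<in> K" for x
    using seq_compactin_subset[OF K] that by blast
  define L where "L = case_prod q ` (K \<times> K)"
  have L: "seq_compactin X L"
    unfolding L_def by (rule seq_compactin_q[OF K K])
  have qL: "q x y \<in> L" if "x \<in> K" "y \<in> K" for x y
    unfolding L_def using that by force
  define \<M> where "\<M> = {M \<in> \<N>. seq_barrier L e M}"
  have exM: "\<exists>M\<in>\<M>. M \<subseteq> U" if "openin X U" "e \<in> U" for U
    using exists_seq_barrier[OF seq_compactin_diagonal[OF L] that] unfolding \<M>_def by auto
  have "countable \<M>"
    unfolding \<M>_def using countable_network by simp
  moreover have "\<M> \<noteq> {}"
    using exM[OF openin_topspace e_in] by auto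
  ultimately have rng: "range (from_nat_into \<M>) = \<M>"
    by simp
  have in_M: "from_nat_into \<M> i \<in> \<N>" "seq_barrier L e (from_nat_into \<M> i)" for i
  proof -
    have "from_nat_into \<M> i \<in> \<M>"
      using rng by (metis rangeI)
    then show "from_nat_into \<M> i \<in> \<N>" "seq_barrier L e (from_nat_into \<M> i)"
      by (simp_all add: \<M>_def)
  qed
  define W where "W n = (\<Inter>i\<le>n. from_nat_into \<M> i)" for n
  have W_closed: "closedin X (W n)" for n
    unfolding W_def using in_M closed_network by (intro closedin_Inter) auto
  have W_e: "e \<in> W n" for n
    unfolding W_def using in_M e_in_network by simp
  have W_barrier: "\<forall>\<^sub>F n in sequentially. \<sigma> n \<in> W m"
    if "\<And>n. \<sigma> n \<in> L" "limitin X \<sigma> e sequentially" for \<sigma> m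
  proof -
    have "range \<sigma> \<subseteq> L"
      using that by auto
    then have "\<forall>\<^sub>F n in sequentially. \<sigma> n \<in> from_nat_into \<M> i" for i
      using in_M(2)[of i] that(2) unfolding seq_barrier_def by simp
    then have "\<forall>\<^sub>F n in sequentially. \<forall>i\<le>m. \<sigma> n \<in> from_nat_into \<M> i"
      by (rule eventually_all_atMost)
    then show ?thesis
      by (rule eventually_mono) (simp add: W_def)
  qed
  have W_anti: "W n \<subseteq> W m" if "m \<le> n" for m n
    using that unfolding W_def by force
  have W_sep: "z = e" if z: "z \<in> topspace X" "\<And>n. z \<in> W n" for z
  proof (rule ccontr)
    assume "z \<noteq> e"
    then obtain M where M: "M \<in> \<M>" "M \<subseteq> topspace X - {z}"
      using exM[OF openin_delete[OF openin_topspace], of z] e_in by auto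
    then obtain i where "from_nat_into \<M> i = M"
      using rng by (metis rangeE)
    then have "z \<in> M"
      using z(2)[of i] by (auto simp: W_def)
    then show False
      using M by auto
  qed
  define E where "E n x y \<longleftrightarrow> q x y \<in> W n \<and> q y x \<in> W n" for n x y
  have E_conv: "\<forall>\<^sub>F i in sequentially. E n (u i) (v i)"
    if u: "\<And>i. u i \<in> K" "limitin X u a sequentially"
      and v: "\<And>i. v i \<in> K" "limitin X v a sequentially" for n u v a
  proof -
    have a: "a \<in> topspace X"
      using u limitin_topspace by metis
    have "limitin X (\<lambda>i. q (u i) (v i)) e sequentially" "limitin X (\<lambda>i. q (v i) (u i)) e sequentially"
      using limit_q[OF u(2) v(2)] limit_q[OF v(2) u(2)] q_self[OF a] by simp_all
    then have "\<forall>\<^sub>F i in sequentially. q (u i) (v i) \<in> W n" "\<forall>\<^sub>F i in sequentially. q (v i) (u i) \<in> W n"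
      using u(1) v(1) by (auto intro!: W_barrier qL)
    then show ?thesis
      unfolding E_def by eventually_elim auto
  qed
  \<comment> \<open>Closedness of the \<open>W n\<close> is used here: the quotient of the limits
    lies in every \<open>W n\<close>, and these meet only in \<open>e\<close>.\<close>
  have E_limit: "x = y" if u: "\<And>i. u i \<in> K" "limitin X u x sequentially"
      and v: "\<And>i. v i \<in> K" "limitin X v y sequentially"
      and E: "\<And>i. E i (u i) (v i)" for u v x y
  proof (rule q_eq_e)
    show xy: "x \<in> topspace X" "y \<in> topspace X"
      using u v limitin_topspace by metis+
    have lim: "limitin X (\<lambda>i. q (u i) (v i)) (q x y) sequentially"
      by (rule limit_q[OF u(2) v(2)])
    show "q x y = e"
    proof (rule W_sep)
      show "q x y \<in> topspace X"
        using xy by (rule q_in)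
      fix n
      have "q (u (i + n)) (v (i + n)) \<in> W n" for i
        using E[of "i + n"] W_anti[of n "i + n"] unfolding E_def by auto
      then show "q x y \<in> W n"
        using closedin_limit_mem[OF W_closed limitin_sequentially_offset[OF lim, of n]] by simp
    qed
  qed
  have E_anti: "E m x y" if "E n x y" "m \<le> n" for m n x y
    using that W_anti[OF that(2)] unfolding E_def by auto
  show ?thesis
  proof (rule that[of E])
    show "E n x x" if "x \<in> K" for n x
      unfolding E_def using q_self[OF KX[OF that]] W_e by simp
    show "E n y x" if "E n x y" for n x y
      using that by (auto simp: E_def)
    show "E n x y" if "E (Suc n) x y" for n x y
      using E_anti[OF that] by simp
    show "x = y" if "x \<in> K" "y \<in> K" "\<And>n. E n x y" for x y
      by (rule E_limit[of "\<lambda>_. x" x "\<lambda>_. y" y]) (use that KX in \<open>auto intro: limit_const\<close>)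
    show "\<forall>\<^sub>F i in sequentially. E n (\<sigma> i) l"
      if "\<And>i. \<sigma> i \<in> K" "l \<in> K" "limitin X \<sigma> l sequentially" for n \<sigma> l
      by (rule E_conv[of \<sigma> l "\<lambda>_. l"]) (use that KX in \<open>auto intro: limit_const\<close>)
    show "\<exists>m. \<forall>x\<in>K. \<forall>y\<in>K. \<forall>z\<in>K. E m x y \<longrightarrow> E m y z \<longrightarrow> E n x z" for n
    proof (rule ccontr)
      assume "\<not> ?thesis"
      then have "\<forall>m. \<exists>x\<in>K. \<exists>y\<in>K. \<exists>z\<in>K. E m x y \<and> E m y z \<and> \<not> E n x z"
        by simp
      then obtain x y z where xyz: "\<And>m. x m \<in> K" "\<And>m. y m \<in> K" "\<And>m. z m \<in> K"
        "\<And>m. E m (x m) (y m)" "\<And>m. E m (y m) (z m)" "\<And>m. \<not> E n (x m) (z m)"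
        by metis
      obtain a r where a: "a \<in> K" "strict_mono r" "limitin X (\<lambda>i. x (r i)) a sequentially"
        by (rule seq_compactinE[OF K xyz(1)])
      obtain b s where b: "b \<in> K" "strict_mono s" "limitin X (\<lambda>i. y (r (s i))) b sequentially"
        by (rule seq_compactinE[OF K, of "\<lambda>i. y (r i)", OF xyz(2)])
      obtain c t where c: "c \<in> K" "strict_mono t" "limitin X (\<lambda>i. z (r (s (t i)))) c sequentially"
        by (rule seq_compactinE[OF K, of "\<lambda>i. z (r (s i))", OF xyz(3)])
      \<comment> \<open>Triples violating composition at ever higher levels are thinned out until
        all three coordinates converge. As \<open>i \<le> j i\<close>, closeness at level
        \<open>j i\<close> gives closeness at level \<open>i\<close>, so the three limits coincide;
        but then the outer coordinates are eventually close at level \<open>n\<close>.\<close>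
      define j where "j = (\<lambda>i. r (s (t i)))"
      have "strict_mono j"
        using strict_mono_o[OF a(2) strict_mono_o[OF b(2) c(2)]] by (simp add: j_def o_def)
      then have ij: "i \<le> j i" for i
        by (rule seq_suble)
      have xa: "limitin X (\<lambda>i. x (j i)) a sequentially"
        using limit_subseq[OF limit_subseq[OF a(3) b(2)] c(2)] by (simp add: j_def)
      have yb: "limitin X (\<lambda>i. y (j i)) b sequentially"
        using limit_subseq[OF b(3) c(2)] by (simp add: j_def)
      have zc: "limitin X (\<lambda>i. z (j i)) c sequentially"
        using c(3) by (simp add: j_def)
      have "E i (x (j i)) (y (j i))" "E i (y (j i)) (z (j i))" for i
        by (rule E_anti[OF _ ij], rule xyz)+
      then have "a = b" "b = c"
        using E_limit[OF _ xa _ yb] E_limit[OF _ yb _ zc] xyz(1-3) by simp_all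
      then have "\<forall>\<^sub>F i in sequentially. E n (x (j i)) (z (j i))"
        using E_conv[OF _ xa, of "\<lambda>i. z (j i)" n] zc xyz(1,3) by simp
      then show False
        using xyz(6) by simp
    qed
  qed
qed

text \<open>Sequences in \<open>K\<close> converge in the metric exactly when they converge in
  \<open>X\<close>: in one direction because quotients enter the barriers, in the other because a
  subsequence staying away from the metric limit would have an \<open>X\<close>-limit, which is
  again that metric limit. As \<open>X\<close> is sequential and \<open>K\<close> is closed, the
  closed sets agree.\<close>

lemma seq_compactin_metrizable:
  assumes K: "seq_compactin X K"
  shows "metrizable_space (subtopology X K) \<and> compact_space (subtopology X K)"
proof (rule seq_compactin_entourages[OF K])
  fix E :: "nat \<Rightarrow> 'a \<Rightarrow> 'a \<Rightarrow> bool"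
  assume refl: "\<And>n x. x \<in> K \<Longrightarrow> E n x x" and sym: "\<And>n x y. E n x y \<Longrightarrow> E n y x"
    and mono: "\<And>n x y. E (Suc n) x y \<Longrightarrow> E n x y"
    and comp: "\<And>n. \<exists>m. \<forall>x\<in>K. \<forall>y\<in>K. \<forall>z\<in>K. E m x y \<longrightarrow> E m y z \<longrightarrow> E n x z"
    and sep: "\<And>x y. \<lbrakk>x \<in> K; y \<in> K; \<And>n. E n x y\<rbrakk> \<Longrightarrow> x = y"
    and conv: "\<And>n \<sigma> l. \<lbrakk>\<And>i. \<sigma> i \<in> K; l \<in> K; limitin X \<sigma> l sequentially\<rbrakk> \<Longrightarrow>
       \<forall>\<^sub>F i in sequentially. E n (\<sigma> i) l"
  have anti: "E m x y" if "E n x y" "m \<le> n" for m n x y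
    using that(2,1) by (induction rule: dec_induct) (auto intro: mono)
  obtain g where g: "\<And>n x y z. \<lbrakk>x \<in> K; y \<in> K; z \<in> K; E (g n) x y; E (g n) y z\<rbrakk> \<Longrightarrow> E n x z"
    using comp by metis
  \<comment> \<open>Thinning out the levels so that each composition costs exactly one step.\<close>
  define j where "j = rec_nat 0 (\<lambda>_ m. max (g m) (Suc m))"
  have j: "j (Suc n) = max (g (j n)) (Suc (j n))" for n
    by (simp add: j_def)
  then have "strict_mono j"
    by (auto simp: strict_mono_Suc_iff)
  then have nj: "n \<le> j n" for n
    by (rule seq_suble)
  obtain d where d: "Metric_space K d"
    and Ed: "\<And>\<epsilon>. 0 < \<epsilon> \<Longrightarrow> \<exists>n. \<forall>x\<in>K. \<forall>y\<in>K. E (j n) x y \<longrightarrow> d x y < \<epsilon>"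
  proof (rule entourage_metric[of K "\<lambda>n. E (j n)"])
    show "E (j n) x z" if "E (j (Suc n)) x y" "E (j (Suc n)) y z" "x \<in> K" "y \<in> K" "z \<in> K" for n x y z
      by (rule g[OF that(3-5)]) (use that(1,2) anti j in auto)
    show "x = y" if "x \<in> K" "y \<in> K" "\<And>n. E (j n) x y" for x y
      by (rule sep[OF that(1,2)]) (use that(3) anti nj in blast)
  qed (use refl sym in auto)
  interpret Metric_space K d
    by (rule d)
  have conv_d: "limitin mtopology \<sigma> l sequentially"
    if \<sigma>: "\<And>i. \<sigma> i \<in> K" "l \<in> K" "limitin X \<sigma> l sequentially" for \<sigma> l
    unfolding limitin_metric
  proof (intro conjI allI impI)
    show "l \<in> K" by fact
    fix \<epsilon> :: real assume "0 < \<epsilon>"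
    then obtain n where n: "\<forall>x\<in>K. \<forall>y\<in>K. E (j n) x y \<longrightarrow> d x y < \<epsilon>"
      using Ed[OF \<open>0 < \<epsilon>\<close>] by blast
    show "\<forall>\<^sub>F i in sequentially. \<sigma> i \<in> K \<and> d (\<sigma> i) l < \<epsilon>"
      using conv[OF \<sigma>, of "j n"] by eventually_elim (use n \<sigma> in auto)
  qed
  have d_conv: "limitin X \<sigma> l sequentially"
    if \<sigma>: "\<And>i. \<sigma> i \<in> K" "limitin mtopology \<sigma> l sequentially" for \<sigma> l
  proof (rule ccontr)
    assume not: "\<not> ?thesis"
    have l: "l \<in> K"
      using \<sigma>(2) by (simp add: limitin_metric)
    then have "l \<in> topspace X"
      using seq_compactin_subset[OF K] by blast
    then obtain U where U: "openin X U" "l \<in> U" "\<not> (\<forall>\<^sub>F i in sequentially. \<sigma> i \<in> U)"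
      using not by (auto simp: limitin_def)
    obtain r :: "nat \<Rightarrow> nat" where r: "strict_mono r" "\<And>i. \<sigma> (r i) \<notin> U"
      using not_eventually_subseq[OF U(3)] by metis
    obtain z s where z: "z \<in> K" "strict_mono s" "limitin X (\<lambda>i. \<sigma> (r (s i))) z sequentially"
      by (rule seq_compactinE[OF K, of "\<lambda>i. \<sigma> (r i)", OF \<sigma>(1)])
    have "limitin mtopology (\<lambda>i. \<sigma> (r (s i))) l sequentially"
      using limitin_subsequence[OF strict_mono_o[OF r(1) z(2)] \<sigma>(2)] by (simp add: o_def)
    then have "z = l"
      using limitin_metric_unique[OF conv_d[OF \<sigma>(1) z(1,3)]] by simp
    then have "\<forall>\<^sub>F i in sequentially. \<sigma> (r (s i)) \<in> U"
      using limitinD[OF z(3) U(1)] U(2) by simp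
    then show False
      using r(2) by simp
  qed
  have KX: "closedin X K"
    by (rule seq_compactin_closedin[OF K])
  have eq: "mtopology = subtopology X K"
  proof (rule topology_eqI_closedin)
    show "topspace mtopology = topspace (subtopology X K)"
      using seq_compactin_subset[OF K] by (auto simp: topspace_subtopology)
    fix A
    show "closedin mtopology A \<longleftrightarrow> closedin (subtopology X K) A"
    proof
      assume "closedin mtopology A"
      then have A: "A \<subseteq> K" "\<And>\<sigma> l. \<lbrakk>range \<sigma> \<subseteq> A; limitin mtopology \<sigma> l sequentially\<rbrakk> \<Longrightarrow> l \<in> A"
        by (auto simp: metric_closedin_iff_sequentially_closed)
      have "closedin X A"
      proof (rule sequential_closedinI[OF sequential])
        show "A \<subseteq> topspace X"
          using A(1) seq_compactin_subset[OF K] by blast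
        fix \<sigma> l assume \<sigma>: "range \<sigma> \<subseteq> A" "limitin X \<sigma> l sequentially"
        then have "\<sigma> i \<in> K" for i
          using A(1) by blast
        moreover from this have "l \<in> K"
          by (rule closedin_limit_mem[OF KX \<sigma>(2)])
        ultimately show "l \<in> A"
          using A(2)[OF \<sigma>(1)] conv_d \<sigma>(2) by simp
      qed
      then show "closedin (subtopology X K) A"
        using A(1) KX by (simp add: closedin_closed_subtopology)
    next
      assume "closedin (subtopology X K) A"
      then have A: "A \<subseteq> K" "closedin X A"
        using KX by (simp_all add: closedin_closed_subtopology)
      show "closedin mtopology A"
        unfolding metric_closedin_iff_sequentially_closed
      proof (intro conjI allI impI)
        show "A \<subseteq> K" by fact
        fix \<sigma> l assume \<sigma>: "range \<sigma> \<subseteq> A \<and> limitin mtopology \<sigma> l sequentially"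
        then have "\<sigma> i \<in> A" for i
          by auto
        moreover from this have "\<sigma> i \<in> K" for i
          using A(1) by blast
        ultimately show "l \<in> A"
          using closedin_limit_mem[OF A(2) d_conv, of \<sigma>] \<sigma> by simp
      qed
    qed
  qed
  have "compact_space mtopology"
    unfolding compact_space_def topspace_mtopology compactin_sequentially
  proof (intro conjI allI impI)
    fix \<sigma> :: "nat \<Rightarrow> 'a" assume "range \<sigma> \<subseteq> K"
    then have \<sigma>: "\<sigma> i \<in> K" for i
      by auto
    obtain l r where "l \<in> K" "strict_mono r" "limitin X (\<lambda>i. \<sigma> (r i)) l sequentially"
      by (rule seq_compactinE[OF K \<sigma>])
    then show "\<exists>l r. l \<in> K \<and> strict_mono r \<and> limitin mtopology (\<sigma> \<circ> r) l sequentially"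
      using conv_d[of "\<lambda>i. \<sigma> (r i)" l] \<sigma> by (auto simp: o_def)
  qed simp
  then show ?thesis
    using metrizable_space_mtopology eq by simp
qed

end

section \<open>Metrization from a countable base at one point\<close>

context rectified_space
begin

lemma continuous_map_p_left: "x \<in> topspace X \<Longrightarrow> continuous_map X X (p x)"
  using continuous_map_compose[OF _ continuous_p, of X "\<lambda>y. (x, y)"]
  by (simp add: continuous_map_pairwise o_def)

lemma continuous_map_q_left: "x \<in> topspace X \<Longrightarrow> continuous_map X X (q x)"
  using continuous_map_compose[OF _ continuous_q, of X "\<lambda>y. (x, y)"]
  by (simp add: continuous_map_pairwise o_def)

lemma continuous_map_q_right: "x \<in> topspace X \<Longrightarrow> continuous_map X X (\<lambda>y. q y x)"
  using continuous_map_compose[OF _ continuous_q, of X "\<lambda>y. (y, x)"]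
  by (simp add: continuous_map_pairwise o_def)

text \<open>Frink's pointwise condition holds for the symmetrized left translates of a base at e.
  Choosing the index of the neighbourhood of x depending on x makes it uniform.\<close>
proposition metrizable_if_first_countable_at_e:
  fixes U :: "nat \<Rightarrow> 'a set"
  assumes U: "\<And>n. openin X (U n)" "\<And>n. e \<in> U n" "\<And>n. U (Suc n) \<subseteq> U n"
    and base: "\<And>S. \<lbrakk>openin X S; e \<in> S\<rbrakk> \<Longrightarrow> \<exists>n. U n \<subseteq> S"
  shows "metrizable_space X"
proof -
  define V where "V n x = {y \<in> topspace X. q x y \<in> U n \<and> q y x \<in> U n}" for n x
  have U_anti: "U n \<subseteq> U m" if "m \<le> n" for m n
    using that U(3) by (rule lift_Suc_antimono_le[rotated])
  have V_anti: "V n x \<subseteq> V m x" if "m \<le> n" for m n x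
    using U_anti[OF that] unfolding V_def by auto
  have V_sym: "x \<in> V n y" if "y \<in> V n x" "x \<in> topspace X" for n x y
    using that unfolding V_def by simp
  have V_refl: "x \<in> V n x" if "x \<in> topspace X" for n x
    using that q_self[OF that] U(2) by (simp add: V_def)
  have V_X: "V n x \<subseteq> topspace X" for n x
    by (auto simp: V_def)
  have V_open: "openin X (V n x)" if "x \<in> topspace X" for n x
  proof -
    have "V n x = {y \<in> topspace X. q x y \<in> U n} \<inter> {y \<in> topspace X. q y x \<in> U n}"
      by (auto simp: V_def)
    then show ?thesis
      using openin_continuous_map_preimage[OF continuous_map_q_left[OF that] U(1)]
        openin_continuous_map_preimage[OF continuous_map_q_right[OF that] U(1)]
      by (simp add: openin_Int)
  qed
  \<comment> \<open>Joint continuity of \<open>p\<close> at \<open>(x, e)\<close> gives one index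
    \<open>m\<close> that works for all centres \<open>y\<close> near \<open>x\<close>.\<close>
  have step: "\<exists>m W. openin X W \<and> x \<in> W \<and> (\<forall>y\<in>W. V m y \<subseteq> S)" if S: "openin X S" "x \<in> S" for x S
  proof -
    obtain W O' where W: "openin X W" "openin X O'" "x \<in> W" "e \<in> O'"
      "\<And>u v. \<lbrakk>u \<in> W; v \<in> O'\<rbrakk> \<Longrightarrow> p u v \<in> S"
      using p_nhd_e[OF S] by metis
    obtain m where m: "U m \<subseteq> O'"
      using base[OF W(2,4)] by auto
    have "V m y \<subseteq> S" if "y \<in> W" for y
    proof
      fix z assume "z \<in> V m y"
      then have z: "z \<in> topspace X" "q y z \<in> O'"
        using m by (auto simp: V_def)
      have "y \<in> topspace X"
        using W(1) that openin_subset by auto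
      then have "z = p y (q y z)"
        using p_q z by simp
      also have "\<dots> \<in> S"
        using W(5) that z by simp
      finally show "z \<in> S" .
    qed
    then show ?thesis
      using W by auto
  qed
  \<comment> \<open>Three uses of \<open>step\<close>, one for each move: from \<open>x\<close> to
    the common point \<open>u\<close>, from \<open>u\<close> to the centre \<open>y\<close> by
    symmetry, and from \<open>y\<close> to any point of its ball.\<close>
  have frink: "\<exists>m>n. \<forall>y\<in>topspace X. V m x \<inter> V m y \<noteq> {} \<longrightarrow> V m y \<subseteq> V n x"
    if x: "x \<in> topspace X" for n x
  proof -
    obtain m1 W1 where 1: "openin X W1" "x \<in> W1" "\<forall>y\<in>W1. V m1 y \<subseteq> V n x"
      using step[OF V_open V_refl, OF x x] by metis
    obtain m2 W2 where 2: "openin X W2" "x \<in> W2" "\<forall>y\<in>W2. V m2 y \<subseteq> W1"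
      using step[OF 1(1,2)] by metis
    obtain m3 W3 where 3: "openin X W3" "x \<in> W3" "\<forall>y\<in>W3. V m3 y \<subseteq> W2"
      using step[OF 2(1,2)] by metis
    define m where "m = Suc (max n (max m1 (max m2 m3)))"
    have m123: "m1 \<le> m" "m2 \<le> m" "m3 \<le> m"
      by (simp_all add: m_def)
    have "V m y \<subseteq> V n x" if y: "y \<in> topspace X" "u \<in> V m x" "u \<in> V m y" for y u
    proof -
      have "u \<in> W2"
        using 3 y(2) V_anti[OF m123(3), of x] by blast
      moreover have "y \<in> V m u"
        by (rule V_sym[OF y(3,1)])
      ultimately have "y \<in> W1"
        using 2 V_anti[OF m123(2), of u] by blast
      then show ?thesis
        using 1 V_anti[OF m123(1), of y] by blast
    qed
    then have "\<forall>y\<in>topspace X. V m x \<inter> V m y \<noteq> {} \<longrightarrow> V m y \<subseteq> V n x"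
      by (meson Int_emptyI)
    moreover have "n < m"
      by (simp add: m_def)
    ultimately show ?thesis
      by metis
  qed
  obtain g where g: "\<And>x n. x \<in> topspace X \<Longrightarrow> n < g x n"
    "\<And>x n y. \<lbrakk>x \<in> topspace X; y \<in> topspace X; V (g x n) x \<inter> V (g x n) y \<noteq> {}\<rbrakk> \<Longrightarrow> V (g x n) y \<subseteq> V n x"
    using frink by metis
  \<comment> \<open>Iterating \<open>g x\<close> separately at each point replaces a uniform index.
    Two points are then called close at level \<open>n\<close> when some ball
    \<open>V (k n x) x\<close> contains both.\<close>
  define k where "k n x = rec_nat 0 (\<lambda>_. g x) n" for n x
  have k_Suc: "k (Suc n) x = g x (k n x)" for n x
    by (simp add: k_def)
  have nk: "n \<le> k n x" if "x \<in> topspace X" for n x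
  proof (rule seq_suble)
    show "strict_mono (\<lambda>n. k n x)"
      using g(1)[OF that] by (simp add: strict_mono_Suc_iff k_Suc)
  qed
  define F where "F n a b \<longleftrightarrow> (\<exists>x\<in>topspace X. a \<in> V (k n x) x \<and> b \<in> V (k n x) x)" for n a b
  \<comment> \<open>Of two balls meeting in \<open>b\<close>, the one with the larger index lies in
    the ball of the smaller index about its own centre, and the pointwise condition at
    \<open>x\<close> puts that into \<open>V (k n x) x\<close>. Since indices are always comparable,
    the other case follows by symmetry.\<close>
  have F_comp1: "F n a c" if x: "x \<in> topspace X" "y \<in> topspace X" "a \<in> V (k (Suc n) x) x"
    "b \<in> V (k (Suc n) x) x" "b \<in> V (k (Suc n) y) y" "c \<in> V (k (Suc n) y) y"
    and le: "k (Suc n) x \<le> k (Suc n) y" for n a b c x y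
  proof -
    have *: "V (k (Suc n) y) y \<subseteq> V (k (Suc n) x) y"
      using V_anti le by simp
    then have "V (g x (k n x)) x \<inter> V (g x (k n x)) y \<noteq> {}"
      using x k_Suc by auto
    then have "V (k (Suc n) x) y \<subseteq> V (k n x) x"
      using g(2)[OF x(1,2)] k_Suc by simp
    then have "c \<in> V (k n x) x"
      using * x(6) by auto
    moreover have "a \<in> V (k n x) x"
    proof -
      have "k n x \<le> k (Suc n) x"
        using g(1)[OF x(1), of "k n x"] by (simp add: k_Suc)
      then show ?thesis
        using x(3) V_anti by auto
    qed
    ultimately show ?thesis
      using x(1) by (auto simp: F_def)
  qed
  have F_sym: "F n b a" if "F n a b" for n a b
    using that by (auto simp: F_def)
  have F_comp: "F n a c" if ab: "F (Suc n) a b" and bc: "F (Suc n) b c" for n a b c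
  proof -
    obtain x y where x: "x \<in> topspace X" "a \<in> V (k (Suc n) x) x" "b \<in> V (k (Suc n) x) x"
      and y: "y \<in> topspace X" "b \<in> V (k (Suc n) y) y" "c \<in> V (k (Suc n) y) y"
      using ab bc by (auto simp: F_def)
    show ?thesis
    proof (cases "k (Suc n) x \<le> k (Suc n) y")
      case True
      then show ?thesis
        using F_comp1[OF x(1) y(1) x(2,3) y(2,3)] by simp
    next
      case False
      then show ?thesis
        using F_comp1[OF y(1) x(1) y(3,2) x(3,2)] F_sym by simp
    qed
  qed
  have F_base: "\<exists>n. \<forall>y. F n x y \<longrightarrow> y \<in> S" if S: "openin X S" "x \<in> S" for x S
  proof -
    have x: "x \<in> topspace X"
      using S openin_subset by auto
    obtain i where i: "V i x \<subseteq> S"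
      using step[OF S] by metis
    obtain m where m: "\<forall>y\<in>topspace X. V m x \<inter> V m y \<noteq> {} \<longrightarrow> V m y \<subseteq> V i x"
      using frink[OF x] by metis
    have "y \<in> S" if "F m x y" for y
    proof -
      obtain z where z: "z \<in> topspace X" "x \<in> V (k m z) z" "y \<in> V (k m z) z"
        using \<open>F m x y\<close> by (auto simp: F_def)
      then have "x \<in> V m z" "y \<in> V m z"
        using V_anti[OF nk[OF z(1)]] by auto
      moreover from this have "V m z \<subseteq> V i x"
        using m z(1) V_refl[OF x] by blast
      ultimately show ?thesis
        using i by blast
    qed
    then show ?thesis by auto
  qed
  obtain d where d: "Metric_space (topspace X) d"
    and dF: "\<And>n. \<exists>\<epsilon>>0. \<forall>x\<in>topspace X. \<forall>y\<in>topspace X. d x y < \<epsilon> \<longrightarrow> F n x y"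
    and Fd: "\<And>\<epsilon>. 0 < \<epsilon> \<Longrightarrow> \<exists>n. \<forall>x\<in>topspace X. \<forall>y\<in>topspace X. F n x y \<longrightarrow> d x y < \<epsilon>"
  proof (rule entourage_metric[of "topspace X" F])
    show "F n x x" if "x \<in> topspace X" for n x
      using that V_refl[OF that] by (auto simp: F_def)
    show "x = y" if xy: "x \<in> topspace X" "y \<in> topspace X" "\<And>n. F n x y" for x y
    proof (rule ccontr)
      assume "x \<noteq> y"
      then have "openin X (topspace X - {y})" "x \<in> topspace X - {y}"
        using xy openin_delete[OF openin_topspace] by auto
      from F_base[OF this] show False
        using xy(3) by auto
    qed
    show "F n y x" if "F n x y" for n x y
      by (rule F_sym[OF that])
    show "F n x z" if "F (Suc n) x y" "F (Suc n) y z" for n x y z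
      by (rule F_comp[OF that])
  qed (rule that)
  interpret Metric_space "topspace X" d
    by (rule d)
  have "openin X S \<longleftrightarrow> openin mtopology S" for S
  proof
    assume S: "openin X S"
    show "openin mtopology S"
      unfolding openin_mtopology
    proof (intro conjI allI impI)
      show "S \<subseteq> topspace X"
        by (rule openin_subset[OF S])
      fix x assume "x \<in> S"
      then obtain n where n: "\<forall>y. F n x y \<longrightarrow> y \<in> S"
        using F_base[OF S] by blast
      obtain \<epsilon> where "\<epsilon> > 0" and \<epsilon>: "\<forall>x\<in>topspace X. \<forall>y\<in>topspace X. d x y < \<epsilon> \<longrightarrow> F n x y"
        using dF[of n] by blast
      have "mball x \<epsilon> \<subseteq> S"
      proof
        fix y assume "y \<in> mball x \<epsilon>"
        then have "F n x y"
          using \<epsilon> by simp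
        then show "y \<in> S"
          using n by simp
      qed
      then show "\<exists>r>0. mball x r \<subseteq> S"
        using \<open>\<epsilon> > 0\<close> by auto
    qed
  next
    assume S: "openin mtopology S"
    have SX: "S \<subseteq> topspace X"
      using S openin_subset by fastforce
    have "\<exists>T. openin X T \<and> x \<in> T \<and> T \<subseteq> S" if xS: "x \<in> S" for x
    proof -
      have x: "x \<in> topspace X"
        using xS SX by auto
      obtain r where r: "r > 0" "mball x r \<subseteq> S"
        using S xS by (auto simp: openin_mtopology)
      obtain n where n: "\<forall>x\<in>topspace X. \<forall>y\<in>topspace X. F n x y \<longrightarrow> d x y < r"
        using Fd[OF r(1)] by blast
      have "V (k n x) x \<subseteq> mball x r"
      proof
        fix y assume y: "y \<in> V (k n x) x"
        then have "F n x y"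
          using V_refl[OF x] x by (auto simp: F_def)
        moreover have "y \<in> topspace X"
          using V_X y by blast
        ultimately show "y \<in> mball x r"
          using n x by simp
      qed
      then have "V (k n x) x \<subseteq> S"
        using r(2) by (rule subset_trans)
      then show ?thesis
        using V_open[OF x] V_refl[OF x] by blast
    qed
    then show "openin X S"
      by (subst openin_subopen) blast
  qed
  then have "X = mtopology"
    by (simp add: topology_eq)
  then show ?thesis
    using metrizable_space_mtopology by simp
qed

end

subsection \<open>Undiagonalizable sheaves\<close>

context cs_rectified_space
begin

text \<open>Otherwise e is the limit of sets containing sequences without convergent subsequences, and
  multiplying their terms from the right by far terms of a non-diagonalizable sheaf at e produces a
  closed set accumulating at e. The far terms are chosen against a countable closed cs-network, which
  forces the sequence of left factors to converge whenever the sequence of products does.\<close>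
proposition seq_compactin_network_near_e:
  assumes not_diag: "\<not> diagonal_at_e (topspace X)"
  shows "\<exists>U. openin X U \<and> e \<in> U \<and> (\<forall>N\<in>\<N>. N \<subseteq> U \<longrightarrow> seq_compactin X N)"
proof (rule ccontr)
  assume "\<not> ?thesis"
  then have bad: "\<exists>N\<in>\<N>. N \<subseteq> U \<and> \<not> seq_compactin X N" if "openin X U" "e \<in> U" for U
    using that by auto
  obtain s :: "nat \<Rightarrow> nat \<Rightarrow> 'a" where s_all: "\<forall>n. range (s n) \<subseteq> topspace X \<and> limitin X (s n) e sequentially"
    and "\<not> (\<exists>r k. strict_mono r \<and> limitin X (\<lambda>n. s (r n) (k n)) e sequentially)"
    using not_diag unfolding diagonal_at_e_def by auto
  then have no_diag: "\<not> limitin X (\<lambda>n. s (r n) (k n)) e sequentially"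
    if "strict_mono r" for r k
    using that by simp
  have s: "s n k \<in> topspace X" "limitin X (s n) e sequentially" for n k
    using s_all by auto
  define \<B> where "\<B> = {N \<in> \<N>. \<not> seq_compactin X N}"
  have "countable \<B>"
    unfolding \<B>_def using countable_network by simp
  moreover have "\<B> \<noteq> {}"
    using bad[OF openin_topspace e_in] by (auto simp: \<B>_def)
  ultimately have rngB: "range (from_nat_into \<B>) = \<B>"
    by simp
  have "\<exists>d :: nat \<Rightarrow> 'a. (\<forall>k. d k \<in> N \<and> d k \<noteq> e) \<and>
      (\<forall>r l. strict_mono r \<longrightarrow> \<not> limitin X (\<lambda>n. d (r n)) l sequentially)" if N: "N \<in> \<B>" for N
  proof -
    have NN: "N \<in> \<N>" "\<not> seq_compactin X N" "closedin X N"
      using N closed_network by (auto simp: \<B>_def)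
    then obtain \<sigma> :: "nat \<Rightarrow> 'a" where \<sigma>: "range \<sigma> \<subseteq> N"
      and *: "\<not> (\<exists>l\<in>N. \<exists>r. strict_mono r \<and> limitin X (\<sigma> \<circ> r) l sequentially)"
      using closedin_subset[OF NN(3)] unfolding seq_compactin_def by auto
    have \<sigma>N: "\<sigma> k \<in> N" for k
      using \<sigma> by auto
    have none: "\<not> limitin X (\<lambda>n. \<sigma> (r n)) l sequentially" if r: "strict_mono r" for r l
    proof
      assume lim: "limitin X (\<lambda>n. \<sigma> (r n)) l sequentially"
      then have "l \<in> N"
        using closedin_limit_mem[OF NN(3) lim] \<sigma>N by simp
      then show False
        using * r lim by (auto simp: o_def)
    qed
    have "\<forall>\<^sub>F k in sequentially. \<sigma> k \<noteq> e"
    proof (rule ccontr)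
      assume "\<not> ?thesis"
      then obtain r :: "nat \<Rightarrow> nat" where r: "strict_mono r" "\<And>k. \<not> \<sigma> (r k) \<noteq> e"
        by (rule not_eventually_subseq) (rule that)
      then have "(\<lambda>n. \<sigma> (r n)) = (\<lambda>n. e)"
        by auto
      then show False
        using none[OF r(1), of e] limit_const[OF e_in] by simp
    qed
    then obtain m where m: "\<And>k. k \<ge> m \<Longrightarrow> \<sigma> k \<noteq> e"
      by (auto simp: eventually_sequentially)
    have "\<not> limitin X (\<lambda>n. \<sigma> (r n + m)) l sequentially" if "strict_mono r" for r l
      using none[of "\<lambda>n. r n + m" l] that by (simp add: strict_mono_def)
    then show ?thesis
      using \<sigma>N m by (intro exI[of _ "\<lambda>k. \<sigma> (k + m)"]) simp
  qed
  then have "\<forall>i. \<exists>d :: nat \<Rightarrow> 'a. (\<forall>k. d k \<in> from_nat_into \<B> i \<and> d k \<noteq> e) \<and>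
      (\<forall>r l. strict_mono r \<longrightarrow> \<not> limitin X (\<lambda>n. d (r n)) l sequentially)"
    using rngB by (metis rangeI)
  then obtain d :: "nat \<Rightarrow> nat \<Rightarrow> 'a" where d_all: "\<forall>i. (\<forall>k. d i k \<in> from_nat_into \<B> i \<and> d i k \<noteq> e) \<and>
      (\<forall>r l. strict_mono r \<longrightarrow> \<not> limitin X (\<lambda>n. d i (r n)) l sequentially)"
    by (rule choice[THEN exE]) (rule that)
  have d: "d i k \<in> from_nat_into \<B> i" "d i k \<noteq> e"
    and d_none: "strict_mono r \<Longrightarrow> \<not> limitin X (\<lambda>n. d i (r n)) l sequentially" for i k r l
    using d_all by auto
  have dX: "d i k \<in> topspace X" for i k
  proof -
    have "from_nat_into \<B> i \<in> \<B>"
      using rngB by (metis rangeI)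
    then have "closedin X (from_nat_into \<B> i)"
      using closed_network by (simp add: \<B>_def)
    then show ?thesis
      using d(1) closedin_subset by blast
  qed
  \<comment> \<open>All products that could be chosen are collected beforehand, so that the network
    is fixed before the choice of the far terms depends on it.\<close>
  define Q where "Q = range (\<lambda>(i, k, j). p (d i k) (s i j))"
  have "countable Q"
    unfolding Q_def by (intro countable_image countableI_type)
  moreover have "Q \<subseteq> topspace X"
    using p_in dX s(1) by (auto simp: Q_def)
  ultimately obtain \<P> where "countable \<P>" and P_closed: "\<And>P. P \<in> \<P> \<Longrightarrow> closedin X P"
    and P_net: "\<And>a x U. \<lbrakk>range a \<subseteq> Q; limitin X a x sequentially; openin X U; x \<in> U\<rbrakk> \<Longrightarrow>
        \<exists>P\<in>\<P>. P \<subseteq> U \<and> (\<forall>\<^sub>F n in sequentially. a n \<in> P)"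
    using countable_closed_cs_network[of Q] by metis
  define \<P>' where "\<P>' = insert {} \<P>"
  have rngP: "range (from_nat_into \<P>') = \<P>'"
    unfolding \<P>'_def using \<open>countable \<P>\<close> by simp
  have P'_closed: "closedin X (from_nat_into \<P>' n)" for n
  proof -
    have "from_nat_into \<P>' n \<in> \<P>'"
      using rngP by (metis rangeI)
    then show ?thesis
      using P_closed by (auto simp: \<P>'_def)
  qed
  \<comment> \<open>The three demands serve different ends: \<open>k \<le> j\<close> puts the right
    factors with large \<open>k\<close> near \<open>e\<close>, the second keeps \<open>e\<close> out
    of the chosen set, and the third separates the product from its left factor no worse than the
    early network members do. Each holds for all large \<open>j\<close>, because the products tend
    to \<open>d i k\<close>, which differs from \<open>e\<close>.\<close>
  define R where "R i k j \<longleftrightarrow> k \<le> j \<and> p (d i k) (s i j) \<noteq> e \<and> (\<forall>n\<le>prod_encode (i, k).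
      d i k \<notin> from_nat_into \<P>' n \<longrightarrow> p (d i k) (s i j) \<notin> from_nat_into \<P>' n)" for i k j
  have "\<exists>j. R i k j" for i k
  proof -
    have lim: "limitin X (\<lambda>j. p (d i k) (s i j)) (d i k) sequentially"
      using limit_p[OF limit_const[OF dX] s(2), of i k i] p_e[OF dX] by simp
    have avoid: "\<forall>\<^sub>F j in sequentially. p (d i k) (s i j) \<notin> C" if "closedin X C" "d i k \<notin> C" for C
    proof -
      have "openin X (topspace X - C)" "d i k \<in> topspace X - C"
        using that dX by auto
      from limitinD[OF lim this] show ?thesis
        by (rule eventually_mono) simp
    qed
    have "\<forall>\<^sub>F j in sequentially. d i k \<notin> from_nat_into \<P>' n \<longrightarrow> p (d i k) (s i j) \<notin> from_nat_into \<P>' n" for n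
      using avoid[OF P'_closed] by (cases "d i k \<in> from_nat_into \<P>' n") simp_all
    then have "\<forall>\<^sub>F j in sequentially. \<forall>n\<le>prod_encode (i, k).
        d i k \<notin> from_nat_into \<P>' n \<longrightarrow> p (d i k) (s i j) \<notin> from_nat_into \<P>' n"
      by (rule eventually_all_atMost)
    moreover have "\<forall>\<^sub>F j in sequentially. p (d i k) (s i j) \<notin> {e}"
      by (rule avoid[OF closedin_singleton[OF e_in]]) (simp add: d(2))
    moreover have "\<forall>\<^sub>F j in sequentially. k \<le> j"
      by (rule eventually_ge_at_top)
    ultimately have "\<forall>\<^sub>F j in sequentially. R i k j"
      unfolding R_def by eventually_elim simp
    from eventually_happens[OF this] show ?thesis
      by simp
  qed
  then have "\<exists>f. \<forall>i k. R i k (f i k)"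
    by metis
  then obtain f where "\<forall>i k. R i k (f i k)"
    by (elim exE)
  then have f: "\<And>i k. k \<le> f i k" "\<And>i k. p (d i k) (s i (f i k)) \<noteq> e"
    "\<And>i k n. \<lbrakk>n \<le> prod_encode (i, k); d i k \<notin> from_nat_into \<P>' n\<rbrakk> \<Longrightarrow>
      p (d i k) (s i (f i k)) \<notin> from_nat_into \<P>' n"
    unfolding R_def by simp_all
  define a where "a i k = p (d i k) (s i (f i k))" for i k
  have aX: "a i k \<in> topspace X" for i k
    unfolding a_def by (rule p_in[OF dX s(1)])
  have aQ: "a i k \<in> Q" for i k
    unfolding a_def Q_def by (rule range_eqI[of _ _ "(i, k, f i k)"]) simp
  \<comment> \<open>If left factors stayed outside a neighbourhood \<open>U\<close> of
    \<open>l\<close>, a network member inside \<open>U\<close> would absorb the products although it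
    contains none of those left factors, against the choice of \<open>f\<close> once the code of the
    pair is large.\<close>
  have d_conv: "limitin X (\<lambda>n. d (i n) (k n)) l sequentially"
    if mono: "strict_mono (\<lambda>n. prod_encode (i n, k n))"
      and lim: "limitin X (\<lambda>n. a (i n) (k n)) l sequentially" for i k l
  proof (rule ccontr)
    assume "\<not> ?thesis"
    then obtain U where U: "openin X U" "l \<in> U" "\<not> (\<forall>\<^sub>F n in sequentially. d (i n) (k n) \<in> U)"
      using limitin_topspace[OF lim] by (auto simp: limitin_def)
    obtain r :: "nat \<Rightarrow> nat" where r: "strict_mono r" "\<And>n. d (i (r n)) (k (r n)) \<notin> U"
      using U(3) by (rule not_eventually_subseq) (rule that)
    have "range (\<lambda>n. a (i (r n)) (k (r n))) \<subseteq> Q"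
      using aQ by auto
    then obtain P where P: "P \<in> \<P>" "P \<subseteq> U" "\<forall>\<^sub>F n in sequentially. a (i (r n)) (k (r n)) \<in> P"
      using P_net[OF _ limit_subseq[OF lim r(1)] U(1,2)] by auto
    have "P \<in> range (from_nat_into \<P>')"
      unfolding rngP using P(1) by (simp add: \<P>'_def)
    then obtain n0 where n0: "from_nat_into \<P>' n0 = P"
      by (metis rangeE)
    obtain m where m: "\<And>n. n \<ge> m \<Longrightarrow> a (i (r n)) (k (r n)) \<in> P"
      using P(3) by (auto simp: eventually_sequentially)
    define n where "n = max m n0"
    have "n0 \<le> n" "m \<le> n"
      by (simp_all add: n_def)
    moreover have "n \<le> r n" "r n \<le> prod_encode (i (r n), k (r n))"
      using seq_suble[OF r(1)] seq_suble[OF mono] by simp_all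
    ultimately have le: "n0 \<le> prod_encode (i (r n), k (r n))"
      by simp
    have "d (i (r n)) (k (r n)) \<notin> from_nat_into \<P>' n0"
      using r(2)[of n] P(2) n0 by blast
    from f(3)[OF le this] show False
      using m[OF \<open>m \<le> n\<close>] n0 by (simp add: a_def)
  qed
  define A where "A = range (\<lambda>(i, k). a i k)"
  have "closedin X A"
  proof (rule sequential_closedinI[OF sequential])
    show "A \<subseteq> topspace X"
      using aX by (auto simp: A_def)
    fix b l assume b: "range b \<subseteq> A" and lim: "limitin X b l sequentially"
    have "\<forall>n. \<exists>ik. b n = a (fst ik) (snd ik)"
    proof
      fix n
      have "b n \<in> A"
        using b by auto
      then show "\<exists>ik. b n = a (fst ik) (snd ik)"
        by (auto simp: A_def)
    qed
    then obtain ik where ik: "\<forall>n. b n = a (fst (ik n)) (snd (ik n))"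
      by (rule choice[THEN exE]) (rule that)
    define i k where "i n = fst (ik n)" and "k n = snd (ik n)" for n
    have b_eq: "b = (\<lambda>n. a (i n) (k n))"
      using ik by (simp add: i_def k_def fun_eq_iff)
    define g where "g n = prod_encode (i n, k n)" for n
    \<comment> \<open>Constant codes put \<open>l\<close> into \<open>A\<close>. Otherwise the left
      factors converge as well: within one row this contradicts the choice of \<open>d\<close>, and
      along increasing rows division would recover a convergent diagonal of the sheaf
      \<open>s\<close>.\<close>
    consider (const) v and r :: "nat \<Rightarrow> nat" where "strict_mono r" "\<And>n. g (r n) = v"
      | (mono) r :: "nat \<Rightarrow> nat" where "strict_mono r" "strict_mono (g \<circ> r)"
      using nat_sequence_constant_or_strict_mono[of g] by auto
    then show "l \<in> A"
    proof cases
      case const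
      have "(i (r n), k (r n)) = prod_decode v" for n
        using const(2)[of n] by (metis g_def prod_encode_inverse)
      then have "b (r n) = a (fst (prod_decode v)) (snd (prod_decode v))" for n
        unfolding b_eq by (metis fst_conv snd_conv)
      then have "limitin X (\<lambda>n. a (fst (prod_decode v)) (snd (prod_decode v))) l sequentially"
        using limit_subseq[OF lim const(1)] by simp
      then have "l = a (fst (prod_decode v)) (snd (prod_decode v))"
        using limit_unique limit_const[OF aX] by metis
      then show ?thesis
        unfolding A_def by auto
    next
      case mono
      have lim_a: "limitin X (\<lambda>n. a (i (r n)) (k (r n))) l sequentially"
        using limit_subseq[OF lim mono(1)] by (simp add: b_eq)
      have g_mono: "strict_mono (\<lambda>n. prod_encode (i (r n), k (r n)))"
        using mono(2) by (simp add: g_def o_def)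
      have lim_d: "limitin X (\<lambda>n. d (i (r n)) (k (r n))) l sequentially"
        by (rule d_conv[OF g_mono lim_a])
      consider (const') v and t :: "nat \<Rightarrow> nat" where "strict_mono t" "\<And>n. i (r (t n)) = v"
        | (mono') t :: "nat \<Rightarrow> nat" where "strict_mono t" "strict_mono ((\<lambda>n. i (r n)) \<circ> t)"
        using nat_sequence_constant_or_strict_mono[of "\<lambda>n. i (r n)"] by auto
      then show ?thesis
      proof cases
        case const'
        consider (c) w and u :: "nat \<Rightarrow> nat" where "strict_mono u" "\<And>n. k (r (t (u n))) = w"
          | (m) u :: "nat \<Rightarrow> nat" where "strict_mono u" "strict_mono ((\<lambda>n. k (r (t n))) \<circ> u)"
          using nat_sequence_constant_or_strict_mono[of "\<lambda>n. k (r (t n))"] by auto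
        then show ?thesis
        proof cases
          case c
          have "strict_mono (\<lambda>n. prod_encode (i (r (t (u n))), k (r (t (u n)))))"
            using strict_mono_o[OF g_mono strict_mono_o[OF const'(1) c(1)]] by (simp add: o_def)
          then have "strict_mono (\<lambda>n::nat. prod_encode (v, w))"
            by (simp add: const'(2) c(2))
          then show ?thesis
            by (simp add: strict_mono_Suc_iff)
        next
          case m
          have "limitin X (\<lambda>n. d v (k (r (t (u n))))) l sequentially"
            using limit_subseq[OF limit_subseq[OF lim_d const'(1)] m(1)] by (simp add: const'(2))
          then show ?thesis
            using d_none[of "\<lambda>n. k (r (t (u n)))" v l] m(2) by (simp add: o_def)
        qed
      next
        case mono'
        have "limitin X (\<lambda>n. q (d (i (r (t n))) (k (r (t n)))) (a (i (r (t n))) (k (r (t n))))) (q l l) sequentially"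
          by (rule limit_q[OF limit_subseq[OF lim_d mono'(1)] limit_subseq[OF lim_a mono'(1)]])
        moreover have "q (d i' k') (a i' k') = s i' (f i' k')" for i' k'
          unfolding a_def by (rule q_p[OF dX s(1)])
        moreover have "q l l = e"
          by (rule q_self[OF limitin_topspace[OF lim]])
        ultimately have "limitin X (\<lambda>n. s (i (r (t n))) (f (i (r (t n))) (k (r (t n))))) e sequentially"
          by simp
        then show ?thesis
          using no_diag[of "\<lambda>n. i (r (t n))" "\<lambda>n. f (i (r (t n))) (k (r (t n)))"] mono'(2)
          by (simp add: o_def)
      qed
    qed
  qed
  have "e \<notin> A"
    using f(2) by (auto simp: A_def a_def)
  then have W: "openin X (topspace X - A)" "p e e \<in> topspace X - A"
    using \<open>closedin X A\<close> p_e[OF e_in] e_in by auto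
  obtain U V where UV: "openin X U" "openin X V" "e \<in> U" "e \<in> V"
    "\<And>u v. \<lbrakk>u \<in> U; v \<in> V\<rbrakk> \<Longrightarrow> p u v \<in> topspace X - A"
    using p_nhd[OF W(1) e_in e_in W(2)] by metis
  obtain N where N: "N \<in> \<N>" "N \<subseteq> U" "\<not> seq_compactin X N"
    using bad[OF UV(1,3)] by auto
  then have "N \<in> range (from_nat_into \<B>)"
    unfolding rngB by (simp add: \<B>_def)
  then obtain i where i: "from_nat_into \<B> i = N"
    by (metis rangeE)
  have "\<forall>\<^sub>F j in sequentially. s i j \<in> V"
    by (rule limitinD[OF s(2) UV(2,4)])
  then obtain j where j: "\<And>j'. j' \<ge> j \<Longrightarrow> s i j' \<in> V"
    by (auto simp: eventually_sequentially)
  \<comment> \<open>The index \<open>j\<close> is used both as a column and as a threshold: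
    \<open>f i j\<close> is at least \<open>j\<close>, so the right factor lies in
    \<open>V\<close>.\<close>
  have "d i j \<in> U"
    using d(1)[of i j] i N(2) by auto
  then have "a i j \<in> topspace X - A"
    unfolding a_def by (rule UV(5)) (rule j[OF f(1)])
  then show False
    by (auto simp: A_def)
qed

end

subsection \<open>The generated clopen subspace and its translates\<close>

locale compactly_absorbing_space = cs_rectified_space +
  fixes \<L> :: "'a set set"
  assumes countable_L: "countable \<L>"
    and seq_compactin_L: "L \<in> \<L> \<Longrightarrow> seq_compactin X L"
    and p_L: "\<lbrakk>L \<in> \<L>; M \<in> \<L>\<rbrakk> \<Longrightarrow> case_prod p ` (L \<times> M) \<in> \<L>"
    and q_L: "\<lbrakk>L \<in> \<L>; M \<in> \<L>\<rbrakk> \<Longrightarrow> case_prod q ` (L \<times> M) \<in> \<L>"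
    and absorb: "limitin X \<sigma> e sequentially \<Longrightarrow> \<exists>L\<in>\<L>. e \<in> L \<and> (\<forall>\<^sub>F n in sequentially. \<sigma> n \<in> L)"
begin

definition H :: "'a set" where "H = \<Union>\<L>"

lemma L_subset_H: "L \<in> \<L> \<Longrightarrow> L \<subseteq> H"
  unfolding H_def by (rule Union_upper)

lemma H_subset: "H \<subseteq> topspace X"
  unfolding H_def using seq_compactin_subset[OF seq_compactin_L] by (rule Union_least)

lemma H_in: "x \<in> H \<Longrightarrow> x \<in> topspace X"
  using H_subset by (rule subsetD)

lemma e_in_H: "e \<in> H"
  using absorb[OF limit_const[OF e_in]] L_subset_H by auto

lemma p_H: assumes "x \<in> H" "y \<in> H" shows "p x y \<in> H"
proof -
  obtain L M where "L \<in> \<L>" "M \<in> \<L>" "x \<in> L" "y \<in> M"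
    using assms by (auto simp: H_def)
  then have "p x y \<in> case_prod p ` (L \<times> M)" "case_prod p ` (L \<times> M) \<in> \<L>"
    by (force intro: p_L)+
  then show ?thesis
    unfolding H_def by (rule UnionI[rotated])
qed

lemma q_H: assumes "x \<in> H" "y \<in> H" shows "q x y \<in> H"
proof -
  obtain L M where "L \<in> \<L>" "M \<in> \<L>" "x \<in> L" "y \<in> M"
    using assms by (auto simp: H_def)
  then have "q x y \<in> case_prod q ` (L \<times> M)" "case_prod q ` (L \<times> M) \<in> \<L>"
    by (force intro: q_L)+
  then show ?thesis
    unfolding H_def by (rule UnionI[rotated])
qed

text \<open>The quotients by \<open>x\<close> are absorbed at \<open>e\<close> by some
  \<open>M\<close>; multiplying \<open>M\<close> from the left by a member containing
  \<open>x\<close> stays within \<open>\<L>\<close>.\<close>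

lemma absorb_at:
  assumes x: "x \<in> H" and lim: "limitin X \<sigma> x sequentially"
  shows "\<exists>L\<in>\<L>. x \<in> L \<and> (\<forall>\<^sub>F n in sequentially. \<sigma> n \<in> L)"
proof -
  have xX: "x \<in> topspace X"
    using x by (rule H_in)
  obtain L where L: "L \<in> \<L>" "x \<in> L"
    using x by (auto simp: H_def)
  have "limitin X (\<lambda>n. q x (\<sigma> n)) e sequentially"
    using limit_q[OF limit_const[OF xX] lim] q_self[OF xX] by simp
  then obtain M where M: "M \<in> \<L>" "e \<in> M" "\<forall>\<^sub>F n in sequentially. q x (\<sigma> n) \<in> M"
    using absorb by auto
  have mem: "p x y \<in> case_prod p ` (L \<times> M)" if "y \<in> M" for y
    using L(2) that by force
  have "\<forall>\<^sub>F n in sequentially. \<sigma> n \<in> topspace X"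
    using limitinD[OF lim openin_topspace xX] .
  with M(3) have "\<forall>\<^sub>F n in sequentially. \<sigma> n \<in> case_prod p ` (L \<times> M)"
  proof eventually_elim
    case (elim n)
    then show ?case
      using mem[OF elim(1)] p_q[OF xX elim(2)] by simp
  qed
  moreover have "x \<in> case_prod p ` (L \<times> M)"
    using mem[OF M(2)] p_e[OF xX] by simp
  ultimately show ?thesis
    by (intro bexI[OF _ p_L[OF L(1) M(1)]] conjI)
qed

text \<open>When a sequence tends to \<open>l\<close>, both the quotients of \<open>l\<close> by its
  terms and the quotients of its terms by \<open>l\<close> enter \<open>H\<close>. Membership in
  \<open>Y\<close> therefore passes from terms to the limit and from the limit to terms, which makes
  \<open>Y\<close> and its complement sequentially closed.\<close>

lemma H_invariant_clopen:
  assumes Y: "Y \<subseteq> topspace X" and inv: "\<And>y h. \<lbrakk>y \<in> Y; h \<in> H\<rbrakk> \<Longrightarrow> p y h \<in> Y"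
  shows "closedin X Y" "openin X Y"
proof -
  show "closedin X Y"
  proof (rule sequential_closedinI[OF sequential Y])
    fix \<sigma> l assume \<sigma>: "range \<sigma> \<subseteq> Y" "limitin X \<sigma> l sequentially"
    have l: "l \<in> topspace X"
      by (rule limitin_topspace[OF \<sigma>(2)])
    have "limitin X (\<lambda>n. q (\<sigma> n) l) e sequentially"
      using limit_q[OF \<sigma>(2) limit_const[OF l]] q_self[OF l] by simp
    then obtain L where L: "L \<in> \<L>" "\<forall>\<^sub>F n in sequentially. q (\<sigma> n) l \<in> L"
      using absorb by auto
    from eventually_happens[OF L(2)] obtain n where "q (\<sigma> n) l \<in> L"
      by auto
    then have "q (\<sigma> n) l \<in> H" "\<sigma> n \<in> Y"
      using L_subset_H[OF L(1)] \<sigma>(1) by auto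
    then have "p (\<sigma> n) (q (\<sigma> n) l) \<in> Y" "\<sigma> n \<in> topspace X"
      using inv Y by auto
    then show "l \<in> Y"
      using p_q l by simp
  qed
  have "closedin X (topspace X - Y)"
  proof (rule sequential_closedinI[OF sequential])
    fix \<sigma> l assume \<sigma>: "range \<sigma> \<subseteq> topspace X - Y" "limitin X \<sigma> l sequentially"
    have l: "l \<in> topspace X"
      by (rule limitin_topspace[OF \<sigma>(2)])
    have "limitin X (\<lambda>n. q l (\<sigma> n)) e sequentially"
      using limit_q[OF limit_const[OF l] \<sigma>(2)] q_self[OF l] by simp
    then obtain L where L: "L \<in> \<L>" "\<forall>\<^sub>F n in sequentially. q l (\<sigma> n) \<in> L"
      using absorb by auto
    from eventually_happens[OF L(2)] obtain n where "q l (\<sigma> n) \<in> L"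
      by auto
    then have n: "q l (\<sigma> n) \<in> H" "\<sigma> n \<in> topspace X" "\<sigma> n \<notin> Y"
      using L_subset_H[OF L(1)] \<sigma>(1) by auto
    then have "l \<notin> Y"
      using inv[of l "q l (\<sigma> n)"] p_q[OF l n(2)] by auto
    then show "l \<in> topspace X - Y"
      using l by simp
  qed simp
  then show "openin X Y"
    using Y by (simp add: openin_closedin_eq)
qed

lemma H_clopen: "closedin X H" "openin X H"
  using H_invariant_clopen[OF H_subset p_H] by auto

text \<open>A convergent sequence in a subset of \<open>H\<close> ends up in one member of
  \<open>\<L>\<close>, so closedness can be tested on the members, which are themselves closed in
  \<open>X\<close>.\<close>

lemma sk_omega_H: "sk_omega_space (subtopology X H)"
  unfolding sk_omega_space_def
proof (intro exI[of _ \<L>] conjI ballI allI impI)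
  have top: "topspace (subtopology X H) = H"
    using H_subset by (auto simp: topspace_subtopology)
  show "countable \<L>"
    by (rule countable_L)
  show "\<Union>\<L> = topspace (subtopology X H)"
    using top by (simp add: H_def)
  have sub: "subtopology (subtopology X H) L = subtopology X L" if "L \<in> \<L>" for L
    using L_subset_H[OF that] by (simp add: subtopology_subtopology inf.absorb2)
  show "compact_space (subtopology (subtopology X H) L)"
    "metrizable_space (subtopology (subtopology X H) L)" if "L \<in> \<L>" for L
    using seq_compactin_metrizable[OF seq_compactin_L[OF that]] sub[OF that] by auto
  fix A assume "A \<subseteq> topspace (subtopology X H)"
  then have A: "A \<subseteq> H"
    using top by simp
  have cl: "closedin (subtopology (subtopology X H) L) (A \<inter> L) \<longleftrightarrow> closedin X (A \<inter> L)"
    if "L \<in> \<L>" for L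
    using sub[OF that] seq_compactin_closedin[OF seq_compactin_L[OF that]]
    by (simp add: closedin_closed_subtopology)
  have clH: "closedin (subtopology X H) A \<longleftrightarrow> closedin X A"
    using A by (simp add: closedin_closed_subtopology[OF H_clopen(1)])
  show "closedin (subtopology X H) A =
    (\<forall>L\<in>\<L>. closedin (subtopology (subtopology X H) L) (A \<inter> L))"
  proof
    assume "closedin (subtopology X H) A"
    then have "closedin X A"
      by (simp add: clH)
    then show "\<forall>L\<in>\<L>. closedin (subtopology (subtopology X H) L) (A \<inter> L)"
      using cl seq_compactin_closedin[OF seq_compactin_L] by (simp add: closedin_Int)
  next
    assume AL: "\<forall>L\<in>\<L>. closedin (subtopology (subtopology X H) L) (A \<inter> L)"
    have "closedin X A"
    proof (rule sequential_closedinI[OF sequential])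
      show "A \<subseteq> topspace X"
        using A H_subset by (rule subset_trans)
      fix \<sigma> l assume \<sigma>: "range \<sigma> \<subseteq> A" "limitin X \<sigma> l sequentially"
      have "\<sigma> n \<in> H" for n
        using \<sigma>(1) A by auto
      then have "l \<in> H"
        by (rule closedin_limit_mem[OF H_clopen(1) \<sigma>(2)])
      then obtain L where L: "L \<in> \<L>" "\<forall>\<^sub>F n in sequentially. \<sigma> n \<in> L"
        using absorb_at[OF _ \<sigma>(2)] by auto
      have "\<forall>\<^sub>F n in sequentially. \<sigma> n \<in> A \<inter> L"
        by (rule eventually_mono[OF L(2)]) (use \<sigma>(1) in auto)
      moreover have "closedin X (A \<inter> L)"
        using AL L(1) cl by auto
      ultimately have "l \<in> A \<inter> L"
        by (intro limitin_closedin[OF \<sigma>(2)]) simp_all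
      then show "l \<in> A" by simp
    qed
    then show "closedin (subtopology X H) A"
      by (simp add: clH)
  qed
qed

lemma rectifiable_H: "rectifiable_space (subtopology X H)"
proof -
  define S where "S = subtopology X H"
  have top: "topspace S = H"
    using H_subset by (auto simp: S_def topspace_subtopology)
  have SS: "prod_topology S S = subtopology (prod_topology X X) (H \<times> H)"
    unfolding S_def by (simp add: subtopology_Times)
  have "continuous_map (prod_topology S S) S (\<lambda>(x, y). p x y)"
    "continuous_map (prod_topology S S) S (\<lambda>(x, y). q x y)"
    unfolding SS unfolding S_def
    using continuous_map_from_subtopology[OF continuous_p] continuous_map_from_subtopology[OF continuous_q]
      p_H q_H by (auto simp: continuous_map_in_subtopology)
  then have cont: "continuous_map (prod_topology S S) (prod_topology S S) (\<lambda>(x, y). (x, p x y))"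
    "continuous_map (prod_topology S S) (prod_topology S S) (\<lambda>(x, y). (x, q x y))"
    by (auto simp: continuous_map_pairwise o_def case_prod_unfold continuous_map_fst)
  have "homeomorphic_maps (prod_topology S S) (prod_topology S S)
      (\<lambda>(x, y). (x, p x y)) (\<lambda>(x, y). (x, q x y))"
    unfolding homeomorphic_maps_def using cont p_q q_p H_in by (auto simp: top)
  then have "homeomorphic_map (prod_topology S S) (prod_topology S S) (\<lambda>(x, y). (x, p x y))"
    by (simp add: homeomorphic_maps_map)
  then show ?thesis
    unfolding rectifiable_space_def S_def[symmetric] top
    using e_in_H p_e[OF H_in] p_H
    by (intro bexI[of _ e] exI[of _ "\<lambda>(x, y). (x, p x y)"]) auto
qed

text \<open>This is the image of \<open>H\<close> under \<open>p c\<close>, written as a preimage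
  under \<open>q c\<close> so that being clopen follows from continuity.\<close>

definition translate :: "'a \<Rightarrow> 'a set" where
  "translate c = {y \<in> topspace X. q c y \<in> H}"

lemma translate_clopen:
  assumes "c \<in> topspace X"
  shows "closedin X (translate c)" "openin X (translate c)"
  unfolding translate_def
  using closedin_continuous_map_preimage[OF continuous_map_q_left[OF assms] H_clopen(1)]
    openin_continuous_map_preimage[OF continuous_map_q_left[OF assms] H_clopen(2)] by auto

lemma translate_self: "c \<in> topspace X \<Longrightarrow> c \<in> translate c"
  using q_self e_in_H by (simp add: translate_def)

text \<open>\<open>q c\<close> and \<open>p c\<close> are mutually inverse continuous maps, so
  \<open>q c\<close> carries \<open>U\<close> onto a clopen part of \<open>H\<close>.\<close>

lemma clopen_in_translate_homeomorphic:
  assumes c: "c \<in> topspace X" and U: "closedin X U" "openin X U" "U \<subseteq> translate c"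
  shows "\<exists>C. closedin (subtopology X H) C \<and> openin (subtopology X H) C \<and>
    subtopology X U homeomorphic_space subtopology (subtopology X H) C"
proof -
  define C where "C = H \<inter> {y \<in> topspace X. p c y \<in> U}"
  have "closedin X C" "openin X C" "C \<subseteq> H"
    unfolding C_def
    using closedin_continuous_map_preimage[OF continuous_map_p_left[OF c] U(1)]
      openin_continuous_map_preimage[OF continuous_map_p_left[OF c] U(2)] H_clopen
    by auto
  then have "closedin (subtopology X H) C" "openin (subtopology X H) C"
    using H_clopen by (simp_all add: closedin_closed_subtopology openin_open_subtopology)
  have UX: "U \<subseteq> topspace X"
    by (rule openin_subset[OF U(2)])
  have U_mem: "q c y \<in> C" if "y \<in> U" for y
    using that U(3) UX p_q[OF c] q_in[OF c] unfolding C_def translate_def by auto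
  have C_mem: "p c y \<in> U" "y \<in> topspace X" if "y \<in> C" for y
    using that by (auto simp: C_def)
  have "homeomorphic_maps (subtopology X U) (subtopology X C) (q c) (p c)"
    unfolding homeomorphic_maps_def
  proof (intro conjI ballI)
    show "continuous_map (subtopology X U) (subtopology X C) (q c)"
      using continuous_map_from_subtopology[OF continuous_map_q_left[OF c]] U_mem
      by (auto simp: continuous_map_in_subtopology)
    show "continuous_map (subtopology X C) (subtopology X U) (p c)"
      using continuous_map_from_subtopology[OF continuous_map_p_left[OF c]] C_mem
      by (auto simp: continuous_map_in_subtopology)
    show "p c (q c y) = y" if "y \<in> topspace (subtopology X U)" for y
      using that p_q[OF c] by simp
    show "q c (p c y) = y" if "y \<in> topspace (subtopology X C)" for y
      using that q_p[OF c] by simp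
  qed
  then have "subtopology X U homeomorphic_space subtopology X C"
    unfolding homeomorphic_space_def by auto
  moreover have "subtopology (subtopology X H) C = subtopology X C"
    using \<open>C \<subseteq> H\<close> by (simp add: subtopology_subtopology inf.absorb2)
  ultimately show ?thesis
    using \<open>closedin (subtopology X H) C\<close> \<open>openin (subtopology X H) C\<close> by auto
qed

text \<open>Products of \<open>x\<close> with members of \<open>\<L>\<close>, bracketed to the left.
  Without associativity a product of two factors from \<open>H\<close> cannot be merged into one, so
  every length must be kept; the union over all lengths is the least set containing \<open>x\<close>
  and stable under right multiplication by \<open>H\<close>.\<close>

primrec orbit_pieces :: "'a \<Rightarrow> nat \<Rightarrow> 'a set set" where
  "orbit_pieces x 0 = {{x}}"
| "orbit_pieces x (Suc n) = (\<lambda>(A, L). case_prod p ` (A \<times> L)) ` (orbit_pieces x n \<times> \<L>)"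

definition orbit :: "'a \<Rightarrow> 'a set" where
  "orbit x = (\<Union>n. \<Union>(orbit_pieces x n))"

lemma seq_compactin_singleton: "x \<in> topspace X \<Longrightarrow> seq_compactin X {x}"
  unfolding seq_compactin_def
proof (intro conjI allI impI)
  fix \<sigma> :: "nat \<Rightarrow> 'a" assume x: "x \<in> topspace X" and "range \<sigma> \<subseteq> {x}"
  then have "\<sigma> \<circ> id = (\<lambda>_. x)"
    by (auto simp: fun_eq_iff)
  then have "limitin X (\<sigma> \<circ> id) x sequentially"
    using limit_const[OF x] by simp
  moreover have "strict_mono (id :: nat \<Rightarrow> nat)"
    by (simp add: strict_mono_def)
  ultimately show "\<exists>l\<in>{x}. \<exists>r. strict_mono r \<and> limitin X (\<sigma> \<circ> r) l sequentially"
    by blast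
qed simp

lemma orbit_pieces:
  assumes "x \<in> topspace X"
  shows "countable (orbit_pieces x n) \<and> (\<forall>A\<in>orbit_pieces x n. seq_compactin X A)"
proof (induction n)
  case 0
  then show ?case
    using seq_compactin_singleton[OF assms] by simp
next
  case (Suc n)
  have "seq_compactin X (case_prod p ` (A \<times> L))" if "A \<in> orbit_pieces x n" "L \<in> \<L>" for A L
    using Suc that seq_compactin_L by (auto intro!: seq_compactin_p)
  then show ?case
    using Suc countable_L by auto
qed

lemma orbit_self: "x \<in> orbit x"
  unfolding orbit_def by (auto intro: exI[of _ 0])

lemma orbit_subset:
  assumes "x \<in> topspace X" shows "orbit x \<subseteq> topspace X"
  unfolding orbit_def using orbit_pieces[OF assms]
  by (intro UN_least Union_least) (simp add: seq_compactin_subset)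

lemma p_orbit:
  assumes "y \<in> orbit x" "h \<in> H" shows "p y h \<in> orbit x"
proof -
  obtain n A L where "A \<in> orbit_pieces x n" "y \<in> A" "L \<in> \<L>" "h \<in> L"
    using assms unfolding orbit_def H_def by auto
  then have "p y h \<in> case_prod p ` (A \<times> L)" "case_prod p ` (A \<times> L) \<in> orbit_pieces x (Suc n)"
    by force+
  then show ?thesis
    unfolding orbit_def by blast
qed

text \<open>Each of the countably many pieces is compact, hence covered by finitely many of the open
  translates centred at its own points.\<close>

lemma orbit_countable_cover:
  assumes x: "x \<in> topspace X"
  obtains C where "countable C" "C \<subseteq> topspace X" "orbit x \<subseteq> (\<Union>c\<in>C. translate c)"
proof -
  define \<A> where "\<A> = (\<Union>n. orbit_pieces x n)"
  have "countable \<A>"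
    unfolding \<A>_def using orbit_pieces[OF x] by auto
  have "\<exists>C. finite C \<and> C \<subseteq> topspace X \<and> A \<subseteq> (\<Union>c\<in>C. translate c)" if "A \<in> \<A>" for A
  proof -
    have A: "seq_compactin X A"
      using that orbit_pieces[OF x] by (auto simp: \<A>_def)
    have AX: "A \<subseteq> topspace X"
      by (rule seq_compactin_subset[OF A])
    have "compactin X A"
      using seq_compactin_metrizable[OF A] AX by (simp add: compactin_subspace)
    moreover have "\<forall>T\<in>translate ` A. openin X T"
      using translate_clopen(2) AX by auto
    moreover have "A \<subseteq> \<Union>(translate ` A)"
      using translate_self AX by auto
    ultimately obtain \<F> where "finite \<F>" "\<F> \<subseteq> translate ` A" "A \<subseteq> \<Union>\<F>"
      using compactinD[of X A "translate ` A"] by blast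
    then obtain C where "C \<subseteq> A" "finite C" "\<F> = translate ` C"
      by (meson finite_subset_image)
    then show ?thesis
      using AX \<open>A \<subseteq> \<Union>\<F>\<close> by (intro exI[of _ C]) auto
  qed
  then obtain C where C: "\<And>A. A \<in> \<A> \<Longrightarrow> finite (C A) \<and> C A \<subseteq> topspace X \<and> A \<subseteq> (\<Union>c\<in>C A. translate c)"
    by metis
  show ?thesis
  proof (rule that[of "\<Union>A\<in>\<A>. C A"])
    show "countable (\<Union>A\<in>\<A>. C A)"
      using C \<open>countable \<A>\<close> by (intro countable_UN) (auto intro: countable_finite)
    show "(\<Union>A\<in>\<A>. C A) \<subseteq> topspace X"
      using C by blast
    show "orbit x \<subseteq> (\<Union>c\<in>(\<Union>A\<in>\<A>. C A). translate c)"
    proof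
      fix y assume "y \<in> orbit x"
      then obtain A where "A \<in> \<A>" "y \<in> A"
        by (auto simp: orbit_def \<A>_def)
      then show "y \<in> (\<Union>c\<in>(\<Union>A\<in>\<A>. C A). translate c)"
        using C[of A] by blast
    qed
  qed
qed

text \<open>Orbits may overlap, since the multiplication need not be associative; but unions of orbits
  are clopen, so a well-ordering of the points makes the orbits disjoint.\<close>
lemma disjoint_clopen_cover:
  "\<exists>\<U>. \<Union>\<U> = topspace X \<and> pairwise disjnt \<U> \<and>
     (\<forall>U\<in>\<U>. closedin X U \<and> openin X U \<and> (\<exists>c\<in>topspace X. U \<subseteq> translate c))"
proof -
  obtain r :: "'a rel" where r: "well_order_on UNIV r"
    using well_order_on by blast
  have wf: "wf (r - Id)" and total: "\<And>x y. x \<noteq> y \<Longrightarrow> (x, y) \<in> r - Id \<or> (y, x) \<in> r - Id"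
    using r by (auto simp: well_order_on_def linear_order_on_def total_on_def)
  \<comment> \<open>The union over all earlier points is again stable under right multiplication by
    \<open>H\<close>, so it is closed however many orbits it contains.\<close>
  define Y where "Y x = (\<Union>y\<in>{y \<in> topspace X. (y, x) \<in> r - Id}. orbit y)" for x
  have Y: "closedin X (Y x)" "openin X (Y x)" for x
    by (rule H_invariant_clopen; use orbit_subset p_orbit in \<open>auto simp: Y_def\<close>)+
  have "\<forall>x\<in>topspace X. \<exists>c :: nat \<Rightarrow> 'a. range c \<subseteq> topspace X \<and> orbit x \<subseteq> (\<Union>n. translate (c n))"
  proof
    fix x assume x: "x \<in> topspace X"
    obtain C where C: "countable C" "C \<subseteq> topspace X" "orbit x \<subseteq> (\<Union>c\<in>C. translate c)"
      by (rule orbit_countable_cover[OF x])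
    have "C \<noteq> {}"
      using C(3) orbit_self[of x] by auto
    then have "range (from_nat_into C) = C"
      using C(1) by simp
    then show "\<exists>c :: nat \<Rightarrow> 'a. range c \<subseteq> topspace X \<and> orbit x \<subseteq> (\<Union>n. translate (c n))"
      using C(2,3) by (intro exI[of _ "from_nat_into C"]) (metis (no_types) image_image)
  qed
  then obtain c where c: "\<forall>x\<in>topspace X. range (c x) \<subseteq> topspace X \<and> orbit x \<subseteq> (\<Union>n::nat. translate (c x n))"
    by (rule bchoice[THEN exE]) (rule that)
  have cX: "c x n \<in> topspace X" if "x \<in> topspace X" for x n
    using c that by auto
  \<comment> \<open>Removing \<open>Y x\<close> separates different orbits; removing the finitely
    many earlier translates separates the pieces within one orbit.\<close>
  define P where "P x n = orbit x \<inter> translate (c x n) - Y x - (\<Union>i<n. translate (c x i))" for x n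
  have P_clopen: "closedin X (P x n)" "openin X (P x n)" if x: "x \<in> topspace X" for x n
  proof -
    have "closedin X (orbit x)" "openin X (orbit x)"
      using H_invariant_clopen[OF orbit_subset[OF x] p_orbit] by simp_all
    moreover have "closedin X (\<Union>i<n. translate (c x i))" "openin X (\<Union>i<n. translate (c x i))"
      using translate_clopen[OF cX[OF x]] by (auto intro!: closedin_Union)
    ultimately show "closedin X (P x n)" "openin X (P x n)"
      unfolding P_def using translate_clopen[OF cX[OF x]] Y
      by (simp_all add: closedin_Int openin_Int closedin_diff openin_diff)
  qed
  have P_disj: "P x n \<inter> P y m = {}" if xy: "x \<in> topspace X" "y \<in> topspace X" "(x, n) \<noteq> (y, m)" for x y n m
  proof (cases "x = y")
    case False
    have "P x n \<inter> P y m = {}" if "(x, y) \<in> r - Id" "x \<in> topspace X" for x y n m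
      using that unfolding P_def Y_def by blast
    then show ?thesis
      using total[OF False] xy by blast
  next
    case True
    have "P x n \<inter> P x m = {}" if "n < m" for n m
      using that unfolding P_def by blast
    then show ?thesis
      using True xy(3) by (metis Int_commute linorder_neqE_nat)
  qed
  define \<U> where "\<U> = (\<lambda>(x, n). P x n) ` (topspace X \<times> UNIV)"
  have "z \<in> \<Union>\<U>" if z: "z \<in> topspace X" for z
  proof -
    \<comment> \<open>The piece containing \<open>z\<close> comes from the least point whose orbit
      contains \<open>z\<close> and then from the least index of a translate.\<close>
    have "z \<in> {x \<in> topspace X. z \<in> orbit x}"
      using z orbit_self by simp
    then obtain x where x: "x \<in> topspace X" "z \<in> orbit x"
      and min: "\<And>y. (y, x) \<in> r - Id \<Longrightarrow> \<not> (y \<in> topspace X \<and> z \<in> orbit y)"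
      by (rule wfE_min[OF wf]) auto
    have "z \<in> (\<Union>n. translate (c x n))"
      using c x by blast
    then have "\<exists>n. z \<in> translate (c x n)"
      by auto
    then have n: "z \<in> translate (c x (LEAST n. z \<in> translate (c x n)))"
      by (rule LeastI_ex)
    have "z \<in> P x (LEAST n. z \<in> translate (c x n))"
      unfolding P_def Y_def using x n min not_less_Least by auto
    then show ?thesis
      using x(1) unfolding \<U>_def by auto
  qed
  moreover have "U \<subseteq> topspace X" if "U \<in> \<U>" for U
    using that P_clopen(2) openin_subset unfolding \<U>_def by blast
  ultimately have "\<Union>\<U> = topspace X"
    by blast
  moreover have "pairwise disjnt \<U>"
  proof (rule pairwiseI)
    fix A B assume "A \<in> \<U>" "B \<in> \<U>" "A \<noteq> B"
    then obtain x n y m where AB: "A = P x n" "x \<in> topspace X" "B = P y m" "y \<in> topspace X"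
      by (auto simp: \<U>_def)
    with \<open>A \<noteq> B\<close> have "(x, n) \<noteq> (y, m)"
      by auto
    then show "disjnt A B"
      using P_disj[OF AB(2,4)] AB(1,3) by (simp add: disjnt_def)
  qed
  moreover have "\<forall>U\<in>\<U>. closedin X U \<and> openin X U \<and> (\<exists>c\<in>topspace X. U \<subseteq> translate c)"
  proof
    fix U assume "U \<in> \<U>"
    then obtain x n where "x \<in> topspace X" "U = P x n"
      unfolding \<U>_def by auto
    moreover have "P x n \<subseteq> translate (c x n)"
      unfolding P_def by auto
    ultimately show "closedin X U \<and> openin X U \<and> (\<exists>c\<in>topspace X. U \<subseteq> translate c)"
      using P_clopen cX by auto
  qed
  ultimately show ?thesis
    by (intro exI[of _ \<U>]) simp
qed

proposition clopen_sk_omega_decomposition: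
  "\<exists>H. closedin X H \<and> openin X H \<and>
       rectifiable_space (subtopology X H) \<and> sk_omega_space (subtopology X H) \<and>
       (\<exists>\<U>. \<Union>\<U> = topspace X \<and> pairwise disjnt \<U> \<and>
          (\<forall>U\<in>\<U>. openin X U \<and>
             (\<exists>C. closedin (subtopology X H) C \<and> openin (subtopology X H) C \<and>
                subtopology X U homeomorphic_space subtopology (subtopology X H) C)))"
proof -
  obtain \<U> where \<U>: "\<Union>\<U> = topspace X" "pairwise disjnt \<U>"
    "\<forall>U\<in>\<U>. closedin X U \<and> openin X U \<and> (\<exists>c\<in>topspace X. U \<subseteq> translate c)"
    using disjoint_clopen_cover by auto
  have "\<forall>U\<in>\<U>. openin X U \<and>
     (\<exists>C. closedin (subtopology X H) C \<and> openin (subtopology X H) C \<and>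
        subtopology X U homeomorphic_space subtopology (subtopology X H) C)"
  proof
    fix U assume "U \<in> \<U>"
    with \<U>(3) obtain c where "closedin X U" "openin X U" "c \<in> topspace X" "U \<subseteq> translate c"
      by auto
    then show "openin X U \<and>
     (\<exists>C. closedin (subtopology X H) C \<and> openin (subtopology X H) C \<and>
        subtopology X U homeomorphic_space subtopology (subtopology X H) C)"
      using clopen_in_translate_homeomorphic[of c U] by simp
  qed
  then show ?thesis
    by (intro exI[of _ H] conjI exI[of _ \<U>] H_clopen rectifiable_H sk_omega_H \<U>(1,2))
qed

end

subsection \<open>From cs*-networks to the decomposition\<close>

lemma diagonal_subsequence:
  fixes P :: "nat \<Rightarrow> nat \<Rightarrow> bool"
  assumes "\<And>n. \<not> eventually (P n) sequentially"
  obtains r :: "nat \<Rightarrow> nat" where "strict_mono r" "\<And>n. \<not> P n (r n)"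
proof -
  have ex: "\<exists>k>m. \<not> P n k" for n m
  proof (rule ccontr)
    assume "\<not> ?thesis"
    then have "\<forall>k\<ge>Suc m. P n k"
      by (auto simp: Suc_le_eq)
    then show False
      using assms[of n] by (auto simp: eventually_sequentially)
  qed
  define g where "g n m = (SOME k. k > m \<and> \<not> P n k)" for n m
  have g: "m < g n m" "\<not> P n (g n m)" for n m
    using someI_ex[OF ex] by (simp_all add: g_def)
  define r where "r = rec_nat (g 0 0) (\<lambda>n m. g (Suc n) m)"
  have r: "r 0 = g 0 0" "r (Suc n) = g (Suc n) (r n)" for n
    by (simp_all add: r_def)
  show ?thesis
  proof (rule that)
    show "strict_mono r"
      using g(1) by (simp add: strict_mono_Suc_iff r)
    show "\<not> P n (r n)" for n
      using g(2) r by (cases n) simp_all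
  qed
qed

text \<open>If no finite union caught the tail, a subsequence could avoid longer and longer initial
  unions. It still converges, so one member contains infinitely many of its terms, although that
  member belongs to all late unions.\<close>

lemma cs_star_network_finite_absorb:
  assumes N: "countable \<N>" "cs_star_network_at X \<N> x"
    and U: "openin X U" "x \<in> U" and lim: "limitin X \<sigma> x sequentially"
  shows "\<exists>\<F>. finite \<F> \<and> \<F> \<noteq> {} \<and> \<F> \<subseteq> {N \<in> \<N>. x \<in> N \<and> N \<subseteq> U} \<and>
    (\<forall>\<^sub>F n in sequentially. \<sigma> n \<in> \<Union>\<F>)"
proof -
  have catch: "\<exists>N\<in>\<N>. x \<in> N \<and> N \<subseteq> U \<and> infinite {n. \<tau> n \<in> N}"
    if "range \<tau> \<subseteq> topspace X" "limitin X \<tau> x sequentially" for \<tau> :: "nat \<Rightarrow> 'a"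
    using N(2) U that unfolding cs_star_network_at_def by simp
  have xX: "x \<in> topspace X"
    by (rule limitin_topspace[OF lim])
  define \<G> where "\<G> = {N \<in> \<N>. x \<in> N \<and> N \<subseteq> U}"
  have "countable \<G>"
    unfolding \<G>_def using N(1) by simp
  moreover have "\<G> \<noteq> {}"
    using catch[of "\<lambda>_. x"] xX by (auto simp: \<G>_def Abstract_Limits.limitin_const_iff)
  ultimately have rng: "range (from_nat_into \<G>) = \<G>"
    by simp
  define G where "G n = from_nat_into \<G> ` {..n}" for n
  have G: "finite (G n)" "G n \<noteq> {}" "G n \<subseteq> \<G>" for n
    using rng by (auto simp: G_def)
  \<comment> \<open>A convergent sequence may have early terms outside the space, while the network
    condition speaks of sequences in it. With this premise the extracted counterexample lies in the
    space.\<close>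
  have "\<exists>n. \<forall>\<^sub>F k in sequentially. \<sigma> k \<in> topspace X \<longrightarrow> \<sigma> k \<in> \<Union>(G n)"
  proof (rule ccontr)
    assume "\<not> ?thesis"
    then have "\<not> (\<forall>\<^sub>F k in sequentially. \<sigma> k \<in> topspace X \<longrightarrow> \<sigma> k \<in> \<Union>(G n))" for n
      by simp
    then obtain r :: "nat \<Rightarrow> nat" where r: "strict_mono r"
      "\<And>n. \<not> (\<sigma> (r n) \<in> topspace X \<longrightarrow> \<sigma> (r n) \<in> \<Union>(G n))"
      by (rule diagonal_subsequence) (rule that)
    then have "range (\<lambda>n. \<sigma> (r n)) \<subseteq> topspace X"
      by auto
    then obtain N where N: "N \<in> \<N>" "x \<in> N" "N \<subseteq> U" "infinite {n. \<sigma> (r n) \<in> N}"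
      using catch[of "\<lambda>n. \<sigma> (r n)"] limitin_subsequence[OF r(1) lim] by (auto simp: o_def)
    then have "N \<in> range (from_nat_into \<G>)"
      unfolding rng by (simp add: \<G>_def)
    then obtain i where i: "from_nat_into \<G> i = N"
      by (metis rangeE)
    have "{n. \<sigma> (r n) \<in> N} \<subseteq> {..<i}"
    proof
      fix n assume n: "n \<in> {n. \<sigma> (r n) \<in> N}"
      show "n \<in> {..<i}"
      proof (rule ccontr)
        assume "n \<notin> {..<i}"
        then have "N \<in> G n"
          using i by (auto simp: G_def)
        then show False
          using r(2)[of n] n by auto
      qed
    qed
    then show False
      using N(4) finite_subset by blast
  qed
  then obtain n where n: "\<forall>\<^sub>F k in sequentially. \<sigma> k \<in> topspace X \<longrightarrow> \<sigma> k \<in> \<Union>(G n)"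
    by auto
  moreover have "\<forall>\<^sub>F k in sequentially. \<sigma> k \<in> topspace X"
    by (rule limitinD[OF lim openin_topspace xX])
  ultimately have "\<forall>\<^sub>F k in sequentially. \<sigma> k \<in> \<Union>(G n)"
    by eventually_elim simp
  then show ?thesis
    using G[of n] unfolding \<G>_def by (intro exI[of _ "G n"] conjI)
qed

text \<open>Regularity puts a closed set between a smaller neighbourhood \<open>V\<close> and
  \<open>U\<close>, so closures of members inside \<open>V\<close> stay inside \<open>U\<close>.
  Finite unions turn infinitely many caught terms into a caught tail.\<close>

lemma (in rectified_space) exists_closed_cs_network:
  assumes N: "countable \<N>" "cs_star_network_at X \<N> e"
  obtains \<N>' where "cs_rectified_space X e p q \<N>'"
proof -
  define \<M> where "\<M> = (\<lambda>N. X closure_of N) ` {N \<in> \<N>. e \<in> N}"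
  define \<N>' where "\<N>' = Union ` {\<F>. finite \<F> \<and> \<F> \<subseteq> \<M> \<and> \<F> \<noteq> {}}"
  have NX: "N \<subseteq> topspace X" if "N \<in> \<N>" for N
    using N(2) that unfolding cs_star_network_at_def by auto
  have M: "closedin X M" "e \<in> M" if "M \<in> \<M>" for M
    using that closure_of_subset[OF NX] by (auto simp: \<M>_def)
  have "cs_rectified_space X e p q \<N>'"
  proof (intro cs_rectified_space.intro rectified_space_axioms cs_rectified_space_axioms.intro)
    have "countable \<M>"
      unfolding \<M>_def using N(1) by simp
    then have "countable {\<F>. finite \<F> \<and> \<F> \<subseteq> \<M>}"
      by (rule countable_Collect_finite_subset)
    then show "countable \<N>'"
      unfolding \<N>'_def by (intro countable_image) (rule countable_subset[rotated], auto)
    show "closedin X N" if "N \<in> \<N>'" for N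
      using that M(1) unfolding \<N>'_def by (auto intro!: closedin_Union)
    show "e \<in> N" if "N \<in> \<N>'" for N
      using that M(2) unfolding \<N>'_def by blast
    show "A \<union> B \<in> \<N>'" if AB: "A \<in> \<N>'" "B \<in> \<N>'" for A B
    proof -
      obtain \<F> \<G> where "finite \<F>" "\<F> \<subseteq> \<M>" "\<F> \<noteq> {}" "A = \<Union>\<F>" "finite \<G>" "\<G> \<subseteq> \<M>" "B = \<Union>\<G>"
        using AB by (auto simp: \<N>'_def)
      then show ?thesis
        unfolding \<N>'_def by (intro image_eqI[of _ _ "\<F> \<union> \<G>"]) auto
    qed
    fix U \<sigma> assume U: "openin X U" "e \<in> U" and lim: "limitin X \<sigma> e sequentially"
    obtain V C where V: "openin X V" "closedin X C" "e \<in> V" "V \<subseteq> C" "C \<subseteq> U"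
      using shrink[OF U] by metis
    obtain \<F> where F: "finite \<F>" "\<F> \<noteq> {}" "\<F> \<subseteq> {N \<in> \<N>. e \<in> N \<and> N \<subseteq> V}"
      "\<forall>\<^sub>F n in sequentially. \<sigma> n \<in> \<Union>\<F>"
      using cs_star_network_finite_absorb[OF N V(1,3) lim] by auto
    define \<F>' where "\<F>' = (\<lambda>N. X closure_of N) ` \<F>"
    have "\<Union>\<F>' \<in> \<N>'"
      unfolding \<N>'_def \<F>'_def \<M>_def using F by (intro imageI) auto
    moreover have "X closure_of N \<subseteq> U" if "N \<in> \<F>" for N
    proof -
      have "N \<subseteq> C"
        using that F(3) V(4) by auto
      then have "X closure_of N \<subseteq> C"
        using V(2) by (rule closure_of_minimal)
      then show ?thesis
        using V(5) by (rule subset_trans)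
    qed
    then have "\<Union>\<F>' \<subseteq> U"
      by (auto simp: \<F>'_def)
    moreover have "\<Union>\<F> \<subseteq> \<Union>\<F>'"
    proof -
      have "N \<subseteq> X closure_of N" if "N \<in> \<F>" for N
        using that F(3) by (intro closure_of_subset NX) auto
      then show ?thesis
        by (auto simp: \<F>'_def)
    qed
    then have "\<forall>\<^sub>F n in sequentially. \<sigma> n \<in> \<Union>\<F>'"
      by (intro eventually_mono[OF F(4)]) (rule subsetD)
    ultimately show "\<exists>N\<in>\<N>'. N \<subseteq> U \<and> (\<forall>\<^sub>F n in sequentially. \<sigma> n \<in> N)"
      by (intro bexI[of _ "\<Union>\<F>'"] conjI)
  qed
  then show ?thesis
    by (rule that)
qed

section \<open>The diagonalizable case and the generated family\<close>

context cs_rectified_space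
begin

text \<open>Barriers in the network are neighbourhoods of \<open>e\<close>; finite intersections of
  the interiors of these countably many members give a decreasing base there.\<close>

lemma metrizable_if_diagonal:
  assumes diag: "diagonal_at_e (topspace X)"
  shows "metrizable_space X"
proof -
  define \<M> where "\<M> = {M \<in> \<N>. \<exists>V. openin X V \<and> e \<in> V \<and> V \<subseteq> M}"
  have exM: "\<exists>M\<in>\<M>. M \<subseteq> S" if S: "openin X S" "e \<in> S" for S
  proof -
    obtain M where M: "M \<in> \<N>" "M \<subseteq> S" "seq_barrier (topspace X) e M"
      using exists_seq_barrier[OF diag S] by auto
    obtain V where "openin X V" "e \<in> V" "V \<subseteq> M"
      by (rule seq_barrier_nhd[OF diag e_in M(3)])
    then show ?thesis
      using M by (auto simp: \<M>_def)
  qed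
  have "countable \<M>"
    unfolding \<M>_def using countable_network by simp
  moreover have "\<M> \<noteq> {}"
    using exM[OF openin_topspace e_in] by auto
  ultimately have rng: "range (from_nat_into \<M>) = \<M>"
    by simp
  have "e \<in> X interior_of (from_nat_into \<M> i)" for i
  proof -
    have "from_nat_into \<M> i \<in> \<M>"
      using rng by (metis rangeI)
    then show ?thesis
      by (auto simp: \<M>_def interior_of_def)
  qed
  note e_int = this
  show ?thesis
  proof (rule metrizable_if_first_countable_at_e)
    fix n
    show "openin X (\<Inter>i\<le>n. X interior_of (from_nat_into \<M> i))"
      by (intro openin_Inter) auto
    show "e \<in> (\<Inter>i\<le>n. X interior_of (from_nat_into \<M> i))"
      using e_int by simp
    show "(\<Inter>i\<le>Suc n. X interior_of (from_nat_into \<M> i)) \<subseteq> (\<Inter>i\<le>n. X interior_of (from_nat_into \<M> i))"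
      by (intro INF_superset_mono) auto
  next
    fix S assume "openin X S" "e \<in> S"
    then obtain M where "M \<in> \<M>" "M \<subseteq> S"
      using exM by auto
    moreover from this obtain i where "from_nat_into \<M> i = M"
      using rng by (metis rangeE)
    ultimately have "X interior_of (from_nat_into \<M> i) \<subseteq> S"
      using interior_of_subset[of X M] by auto
    then have "(\<Inter>j\<le>i. X interior_of (from_nat_into \<M> j)) \<subseteq> S"
      by auto
    then show "\<exists>n. (\<Inter>i\<le>n. X interior_of (from_nat_into \<M> i)) \<subseteq> S"
      by (rule exI)
  qed
qed

text \<open>Each level keeps the previous one, so any two members of the union occur at a common
  level and their products appear at the next.\<close>

primrec product_level :: "'a set set \<Rightarrow> nat \<Rightarrow> 'a set set" where
  "product_level \<K> 0 = \<K>"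
| "product_level \<K> (Suc n) = product_level \<K> n \<union>
     (\<lambda>(A, B). case_prod p ` (A \<times> B)) ` (product_level \<K> n \<times> product_level \<K> n) \<union>
     (\<lambda>(A, B). case_prod q ` (A \<times> B)) ` (product_level \<K> n \<times> product_level \<K> n)"

lemma product_level_mono: "m \<le> n \<Longrightarrow> product_level \<K> m \<subseteq> product_level \<K> n"
  by (rule lift_Suc_mono_le) auto

text \<open>Non-metrizability yields a sheaf that cannot be diagonalized, hence a neighbourhood
  \<open>U\<close> in which all network members are sequentially compact. These already absorb
  sequences tending to \<open>e\<close>, and closing them up under \<open>p\<close> and
  \<open>q\<close> keeps them countable and sequentially compact.\<close>

lemma compactly_absorbing_if_not_metrizable:
  assumes "\<not> metrizable_space X"
  obtains \<L> where "compactly_absorbing_space X e p q \<N> \<L>"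
proof -
  obtain U where U: "openin X U" "e \<in> U" and compact: "\<And>N. \<lbrakk>N \<in> \<N>; N \<subseteq> U\<rbrakk> \<Longrightarrow> seq_compactin X N"
    using seq_compactin_network_near_e metrizable_if_diagonal assms by auto
  define \<K> where "\<K> = {N \<in> \<N>. N \<subseteq> U}"
  have level: "countable (product_level \<K> n) \<and> (\<forall>A\<in>product_level \<K> n. seq_compactin X A)" for n
  proof (induction n)
    case 0
    then show ?case
      using countable_network compact by (simp add: \<K>_def)
  next
    case (Suc n)
    then show ?case
      by (auto intro: seq_compactin_p seq_compactin_q)
  qed
  define \<L> where "\<L> = (\<Union>n. product_level \<K> n)"
  have common: "\<exists>n. A \<in> product_level \<K> n \<and> B \<in> product_level \<K> n" if AB: "A \<in> \<L>" "B \<in> \<L>" for A B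
  proof -
    obtain m n where "A \<in> product_level \<K> m" "B \<in> product_level \<K> n"
      using AB by (auto simp: \<L>_def)
    then show ?thesis
      using product_level_mono[of m "max m n" \<K>] product_level_mono[of n "max m n" \<K>]
      by (intro exI[of _ "max m n"]) auto
  qed
  have "compactly_absorbing_space X e p q \<N> \<L>"
  proof (intro compactly_absorbing_space.intro cs_rectified_space_axioms
      compactly_absorbing_space_axioms.intro)
    show "countable \<L>"
      unfolding \<L>_def using level by auto
    show "seq_compactin X L" if "L \<in> \<L>" for L
      using that level by (auto simp: \<L>_def)
    fix A B assume "A \<in> \<L>" "B \<in> \<L>"
    then obtain n where n: "A \<in> product_level \<K> n" "B \<in> product_level \<K> n"
      using common by auto
    have "case_prod p ` (A \<times> B) \<in> product_level \<K> (Suc n)"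
      "case_prod q ` (A \<times> B) \<in> product_level \<K> (Suc n)"
      using n by (force intro!: image_eqI[of _ _ "(A, B)"])+
    then show "case_prod p ` (A \<times> B) \<in> \<L>" "case_prod q ` (A \<times> B) \<in> \<L>"
      unfolding \<L>_def by blast+
  next
    fix \<sigma> assume "limitin X \<sigma> e sequentially"
    then obtain N where N: "N \<in> \<N>" "N \<subseteq> U" "\<forall>\<^sub>F n in sequentially. \<sigma> n \<in> N"
      using network[OF U] by auto
    then have "N \<in> product_level \<K> 0"
      by (simp add: \<K>_def)
    then have "N \<in> \<L>"
      unfolding \<L>_def by blast
    then show "\<exists>L\<in>\<L>. e \<in> L \<and> (\<forall>\<^sub>F n in sequentially. \<sigma> n \<in> L)"
      using N(3) e_in_network[OF N(1)] by (intro bexI[of _ N] conjI)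
  qed
  then show ?thesis
    by (rule that)
qed

end

text \<open>Only \<open>h\<close> is assumed to preserve the fibres
  \<open>{x} \<times> topspace X\<close>, and only by inclusion. For the inverse \<open>g\<close>
  this follows: \<open>h\<close> keeps the first coordinate of \<open>g (x, y)\<close> and sends
  that pair to \<open>(x, y)\<close>.\<close>

lemma rectifiable_imp_rectified:
  assumes "regular_space X" "t1_space X" "sequential_space X" "rectifiable_space X"
  obtains e p q where "rectified_space X e p q"
proof -
  obtain e h where e: "e \<in> topspace X"
    and h: "homeomorphic_map (prod_topology X X) (prod_topology X X) h"
    and he: "\<And>x. x \<in> topspace X \<Longrightarrow> h (x, e) = (x, x)"
    and hx: "\<And>x. x \<in> topspace X \<Longrightarrow> h ` ({x} \<times> topspace X) \<subseteq> {x} \<times> topspace X"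
    using assms(4) unfolding rectifiable_space_def by auto
  obtain g where g: "homeomorphic_maps (prod_topology X X) (prod_topology X X) h g"
    using h homeomorphic_map_maps by blast
  then have cont: "continuous_map (prod_topology X X) (prod_topology X X) h"
    "continuous_map (prod_topology X X) (prod_topology X X) g"
    and gh: "\<And>x y. \<lbrakk>x \<in> topspace X; y \<in> topspace X\<rbrakk> \<Longrightarrow> g (h (x, y)) = (x, y)"
    and hg: "\<And>x y. \<lbrakk>x \<in> topspace X; y \<in> topspace X\<rbrakk> \<Longrightarrow> h (g (x, y)) = (x, y)"
    by (auto simp: homeomorphic_maps_def)
  define p where "p x y = snd (h (x, y))" for x y
  define q where "q x y = snd (g (x, y))" for x y
  have h_eq: "h (x, y) = (x, p x y)" "p x y \<in> topspace X"
    if "x \<in> topspace X" "y \<in> topspace X" for x y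
  proof -
    have "h (x, y) \<in> {x} \<times> topspace X"
      using hx[OF that(1)] that(2) by auto
    then show "h (x, y) = (x, p x y)" "p x y \<in> topspace X"
      by (auto simp: p_def)
  qed
  have g_eq: "g (x, y) = (x, q x y)" "q x y \<in> topspace X"
    if xy: "x \<in> topspace X" "y \<in> topspace X" for x y
  proof -
    have "g (x, y) \<in> topspace X \<times> topspace X"
      using continuous_map_image_subset_topspace[OF cont(2)] xy by auto
    then obtain a b where ab: "g (x, y) = (a, b)" "a \<in> topspace X" "b \<in> topspace X"
      by auto
    have "h (a, b) = (x, y)"
      using hg[OF xy] ab(1) by simp
    then have "a = x"
      using h_eq(1)[OF ab(2,3)] by simp
    then show "g (x, y) = (x, q x y)" "q x y \<in> topspace X"
      using ab by (simp_all add: q_def)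
  qed
  have "rectified_space X e p q"
  proof
    have "continuous_map (prod_topology X X) X (snd \<circ> h)" "continuous_map (prod_topology X X) X (snd \<circ> g)"
      by (rule continuous_map_compose[OF cont(1) continuous_map_snd],
          rule continuous_map_compose[OF cont(2) continuous_map_snd])
    then show "continuous_map (prod_topology X X) X (\<lambda>(x, y). p x y)"
      "continuous_map (prod_topology X X) X (\<lambda>(x, y). q x y)"
      by (simp_all add: p_def q_def o_def case_prod_unfold)
    show "p x e = x" if "x \<in> topspace X" for x
      using he[OF that] by (simp add: p_def)
    show "p x (q x y) = y" if "x \<in> topspace X" "y \<in> topspace X" for x y
      using hg[OF that] g_eq[OF that] by (simp add: p_def)
    show "q x (p x y) = y" if "x \<in> topspace X" "y \<in> topspace X" for x y
      using gh[OF that] h_eq[OF that] by (simp add: q_def)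
  qed (use assms e in auto)
  then show ?thesis
    by (rule that)
qed

theorem theorem1p1:
  fixes X :: "'a topology"
  assumes "regular_space X" and "t1_space X"
    and "\<not> metrizable_space X"
    and "sequential_space X"
    and "rectifiable_space X"
    and "countable_cs_star_character X"
  shows "\<exists>H. closedin X H \<and> openin X H \<and>
           rectifiable_space (subtopology X H) \<and> sk_omega_space (subtopology X H) \<and>
           (\<exists>\<U>. \<Union>\<U> = topspace X \<and> pairwise disjnt \<U> \<and>
              (\<forall>U\<in>\<U>. openin X U \<and>
                 (\<exists>C. closedin (subtopology X H) C \<and> openin (subtopology X H) C \<and>
                    subtopology X U homeomorphic_space subtopology (subtopology X H) C)))"
proof -
  obtain e p q where rect: "rectified_space X e p q"
    using assms(1,2,4,5) by (rule rectifiable_imp_rectified)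
  obtain \<N> where "countable \<N>" "cs_star_network_at X \<N> e"
    using assms(6) rectified_space.e_in[OF rect] unfolding countable_cs_star_character_def by auto
  then obtain \<N>' where "cs_rectified_space X e p q \<N>'"
    by (rule rectified_space.exists_closed_cs_network[OF rect])
  then obtain \<L> where "compactly_absorbing_space X e p q \<N>' \<L>"
    by (rule cs_rectified_space.compactly_absorbing_if_not_metrizable[OF _ assms(3)])
  then show ?thesis
    by (rule compactly_absorbing_space.clopen_sk_omega_decomposition)
qed

end
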